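(* There exist a finite group $G$ and subgroups $H_1,H_2\le G$ such that the action of $G$ on $[H_1\backslash G]$ has rank $5$ and $H_1,H_2$ are locally integrally equivalent, but the $G$-sets $[H_1\backslash G]$ and $[H_2\backslash G]$ are not isomorphic.
   Context: For a finite group $G$ and a subgroup $H\le G$, $[H\backslash G]$ denotes the set of right cosets of $H$ in $G$ with the right action of $G$; for a commutative ring $R$, $R[H\backslash G]$ is the free $R$-module with basis $[H\backslash G]$, with the $R$-linear extension of the $G$-action. Subgroups $H_1,H_2\le G$ are locally integrally equivalent if $\mathbf{Z}_p[H_1\backslash G]\simeq \mathbf{Z}_p[H_2\backslash G]$ as $\mathbf{Z}_p[G]$-modules for every prime $p$ ($\mathbf{Z}_p$ the $p$-adic integers); equivalently, the $\mathbf{Z}[G]$-modules $\mathbf{Z}[H_1\backslash G]$ and $\mathbf{Z}[H_2\backslash G]$ lie in the same genus. The rank of a group $G$ acting on a finite set $\Omega$ is the number of orbits of the diagonal action of $G$ on $\Omega\times\Omega$. *)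

theory Defs
  imports
    "HOL-Computational_Algebra.Primes"
    "HOL-Algebra.Group_Action"
    "HOL-Algebra.Module"
begin

section \<open>The ring of p-adic integers\<close>

text \<open>The inverse limit of the rings of integers modulo \<open>p ^ n\<close>: coherent sequences of
  least nonnegative residues, with componentwise operations.\<close>

definition padic_int :: "nat \<Rightarrow> (nat \<Rightarrow> int) ring" where
  "padic_int p =
    \<lparr> carrier = {x. \<forall>n. x n \<in> {0..<int p ^ n} \<and> x (Suc n) mod int p ^ n = x n},
      monoid.mult = (\<lambda>x y n. (x n * y n) mod int p ^ n),
      one = (\<lambda>n. 1 mod int p ^ n),
      zero = (\<lambda>n. 0),
      add = (\<lambda>x y n. (x n + y n) mod int p ^ n) \<rparr>"

lemma mod_power_Suc_mod: "(a mod (q::int) ^ Suc n) mod q ^ n = a mod q ^ n"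
  by (simp add: mod_mod_cancel)

lemma padic_int_cring:
  assumes "p > 0"
  shows "cring (padic_int p)"
proof (rule cringI)
  let ?R = "padic_int p"
  have pos: "int p ^ n > 0" for n using assms by simp
  have red: "x n mod int p ^ n = x n" if "x \<in> carrier ?R" for x n
    using that by (auto simp: padic_int_def)
  have coh: "x (Suc n) mod int p ^ n = x n" if "x \<in> carrier ?R" for x n
    using that by (auto simp: padic_int_def)
  have memI: "(\<lambda>n. f n mod int p ^ n) \<in> carrier ?R"
    if "\<And>n. f (Suc n) mod int p ^ n = f n mod int p ^ n" for f
    using that pos by (simp add: padic_int_def mod_power_Suc_mod del: power_Suc)
  have add_c: "x \<oplus>\<^bsub>?R\<^esub> y \<in> carrier ?R" if "x \<in> carrier ?R" "y \<in> carrier ?R" for x y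
  proof -
    have "(\<lambda>n. (x n + y n) mod int p ^ n) \<in> carrier ?R"
      by (rule memI) (metis coh[OF that(1)] coh[OF that(2)] mod_add_eq)
    then show ?thesis by (simp add: padic_int_def)
  qed
  have mult_c: "x \<otimes>\<^bsub>?R\<^esub> y \<in> carrier ?R" if "x \<in> carrier ?R" "y \<in> carrier ?R" for x y
  proof -
    have "(\<lambda>n. (x n * y n) mod int p ^ n) \<in> carrier ?R"
      by (rule memI) (metis coh[OF that(1)] coh[OF that(2)] mod_mult_eq)
    then show ?thesis by (simp add: padic_int_def)
  qed
  have zero_c: "\<zero>\<^bsub>?R\<^esub> \<in> carrier ?R"
    using memI[of "\<lambda>_. 0"] by (simp add: padic_int_def)
  have one_c: "\<one>\<^bsub>?R\<^esub> \<in> carrier ?R"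
    using memI[of "\<lambda>_. 1"] by (simp add: padic_int_def)
  show "abelian_group ?R"
  proof (rule abelian_groupI)
    fix x assume x: "x \<in> carrier ?R"
    have m: "(\<lambda>n. (- x n) mod int p ^ n) \<in> carrier ?R"
      by (rule memI) (metis coh[OF x] mod_minus_eq)
    show "\<exists>y\<in>carrier ?R. y \<oplus>\<^bsub>?R\<^esub> x = \<zero>\<^bsub>?R\<^esub>"
      by (rule bexI[OF _ m]) (simp add: padic_int_def mod_simps)
    show "\<zero>\<^bsub>?R\<^esub> \<oplus>\<^bsub>?R\<^esub> x = x"
      using red[OF x] by (simp add: padic_int_def)
  next
    fix x y z
    show "x \<oplus>\<^bsub>?R\<^esub> y \<oplus>\<^bsub>?R\<^esub> z = x \<oplus>\<^bsub>?R\<^esub> (y \<oplus>\<^bsub>?R\<^esub> z)"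
      by (simp add: padic_int_def mod_simps add.assoc)
    show "x \<oplus>\<^bsub>?R\<^esub> y = y \<oplus>\<^bsub>?R\<^esub> x"
      by (simp add: padic_int_def add.commute)
  qed (use add_c zero_c in auto)
  show "Group.comm_monoid ?R"
  proof (rule comm_monoidI)
    fix x assume x: "x \<in> carrier ?R"
    show "\<one>\<^bsub>?R\<^esub> \<otimes>\<^bsub>?R\<^esub> x = x"
      using red[OF x] by (simp add: padic_int_def mod_simps)
  next
    fix x y z
    show "x \<otimes>\<^bsub>?R\<^esub> y \<otimes>\<^bsub>?R\<^esub> z = x \<otimes>\<^bsub>?R\<^esub> (y \<otimes>\<^bsub>?R\<^esub> z)"
      by (simp add: padic_int_def mod_simps mult.assoc)
    show "x \<otimes>\<^bsub>?R\<^esub> y = y \<otimes>\<^bsub>?R\<^esub> x"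
      by (simp add: padic_int_def mult.commute)
  qed (use mult_c one_c in auto)
  fix x y z
  show "(x \<oplus>\<^bsub>?R\<^esub> y) \<otimes>\<^bsub>?R\<^esub> z = x \<otimes>\<^bsub>?R\<^esub> z \<oplus>\<^bsub>?R\<^esub> y \<otimes>\<^bsub>?R\<^esub> z"
    by (simp add: padic_int_def mod_simps distrib_right)
qed

section \<open>Right G-sets\<close>

text \<open>A right action on \<open>\<Omega>\<close> is given by \<open>act :: 'g \<Rightarrow> 'x \<Rightarrow> 'x\<close>, where \<open>act g x\<close> stands for
  \<open>x g\<close>; thus \<open>act (g h) x = act h (act g x)\<close>.  The orbits of such an action are still
  the library's \<open>orbits\<close>.\<close>

definition coset_act :: "('g, 'm) monoid_scheme \<Rightarrow> 'g \<Rightarrow> 'g set \<Rightarrow> 'g set" where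
  "coset_act G g A = A #>\<^bsub>G\<^esub> g"

definition action_rank ::
    "('g, 'm) monoid_scheme \<Rightarrow> 'x set \<Rightarrow> ('g \<Rightarrow> 'x \<Rightarrow> 'x) \<Rightarrow> nat" where
  "action_rank G \<Omega> act = card (orbits G (\<Omega> \<times> \<Omega>) (\<lambda>g (x, y). (act g x, act g y)))"

definition gset_isomorphic ::
    "('g, 'm) monoid_scheme \<Rightarrow> 'x set \<Rightarrow> ('g \<Rightarrow> 'x \<Rightarrow> 'x) \<Rightarrow> 'y set \<Rightarrow> ('g \<Rightarrow> 'y \<Rightarrow> 'y) \<Rightarrow> bool"
  where
  "gset_isomorphic G \<Omega>1 act1 \<Omega>2 act2 \<longleftrightarrow>
    (\<exists>f. bij_betw f \<Omega>1 \<Omega>2 \<and>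
         (\<forall>g\<in>carrier G. \<forall>x\<in>\<Omega>1. f (act1 g x) = act2 g (f x)))"

section \<open>Permutation modules\<close>

text \<open>The free \<open>R\<close>-module on a finite set \<open>\<Omega>\<close>, an element being its family of
  coefficients.  The fields \<open>mult\<close> and \<open>one\<close> come from the record type and play no role
  for modules.\<close>

definition free_mod :: "('r, 'm) ring_scheme \<Rightarrow> 'x set \<Rightarrow> ('r, 'x \<Rightarrow> 'r) module" where
  "free_mod R \<Omega> =
    \<lparr> carrier = \<Omega> \<rightarrow>\<^sub>E carrier R,
      monoid.mult = undefined,
      one = undefined,
      zero = (\<lambda>x\<in>\<Omega>. \<zero>\<^bsub>R\<^esub>),
      add = (\<lambda>u v. \<lambda>x\<in>\<Omega>. u x \<oplus>\<^bsub>R\<^esub> v x),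
      smult = (\<lambda>r u. \<lambda>x\<in>\<Omega>. r \<otimes>\<^bsub>R\<^esub> u x) \<rparr>"

lemma free_mod_module:
  assumes "cring R"
  shows "module R (free_mod R \<Omega>)"
proof -
  interpret cring R by fact
  let ?M = "free_mod R \<Omega>"
  have c: "u x \<in> carrier R" if "u \<in> \<Omega> \<rightarrow>\<^sub>E carrier R" "x \<in> \<Omega>" for u x
    using that by (rule PiE_mem)
  have eqI: "(\<lambda>x\<in>\<Omega>. f x) = (\<lambda>x\<in>\<Omega>. h x)" if "\<And>x. x \<in> \<Omega> \<Longrightarrow> f x = h x"
    for f h :: "_ \<Rightarrow> 'a"
    using that by (rule restrict_ext)
  have ab: "abelian_group ?M"
  proof (rule abelian_groupI)
    fix u assume u: "u \<in> carrier ?M"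
    then have u': "u \<in> \<Omega> \<rightarrow>\<^sub>E carrier R" by (simp add: free_mod_def)
    have "(\<lambda>x\<in>\<Omega>. \<ominus>\<^bsub>R\<^esub> u x) \<in> carrier ?M"
      using c[OF u'] by (simp add: free_mod_def restrict_PiE_iff)
    moreover have "(\<lambda>x\<in>\<Omega>. \<ominus>\<^bsub>R\<^esub> u x) \<oplus>\<^bsub>?M\<^esub> u = \<zero>\<^bsub>?M\<^esub>"
      using c[OF u'] by (simp add: free_mod_def l_neg cong: restrict_cong)
    ultimately show "\<exists>v\<in>carrier ?M. v \<oplus>\<^bsub>?M\<^esub> u = \<zero>\<^bsub>?M\<^esub>" by blast
    have "(\<lambda>x\<in>\<Omega>. \<zero>\<^bsub>R\<^esub> \<oplus>\<^bsub>R\<^esub> u x) = (\<lambda>x\<in>\<Omega>. u x)"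
      using c[OF u'] by (intro eqI) simp
    also have "\<dots> = u" using u' by (rule PiE_restrict)
    finally show "\<zero>\<^bsub>?M\<^esub> \<oplus>\<^bsub>?M\<^esub> u = u"
      by (simp add: free_mod_def cong: restrict_cong)
  next
    fix u v w assume "u \<in> carrier ?M" "v \<in> carrier ?M" "w \<in> carrier ?M"
    then show "u \<oplus>\<^bsub>?M\<^esub> v \<oplus>\<^bsub>?M\<^esub> w = u \<oplus>\<^bsub>?M\<^esub> (v \<oplus>\<^bsub>?M\<^esub> w)"
      by (simp add: free_mod_def c a_assoc cong: restrict_cong)
  next
    fix u v assume "u \<in> carrier ?M" "v \<in> carrier ?M"
    then have "(\<lambda>x\<in>\<Omega>. u x \<oplus>\<^bsub>R\<^esub> v x) = (\<lambda>x\<in>\<Omega>. v x \<oplus>\<^bsub>R\<^esub> u x)"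
      by (intro eqI a_comm) (simp_all add: free_mod_def c)
    then show "u \<oplus>\<^bsub>?M\<^esub> v = v \<oplus>\<^bsub>?M\<^esub> u" by (simp add: free_mod_def)
  qed (simp_all add: free_mod_def restrict_PiE_iff c)
  show ?thesis
  proof (rule moduleI[OF \<open>cring R\<close> ab])
    fix u assume "u \<in> carrier ?M"
    then have u': "u \<in> \<Omega> \<rightarrow>\<^sub>E carrier R" by (simp add: free_mod_def)
    have "(\<lambda>x\<in>\<Omega>. \<one>\<^bsub>R\<^esub> \<otimes>\<^bsub>R\<^esub> u x) = (\<lambda>x\<in>\<Omega>. u x)"
      using c[OF u'] by (intro eqI) simp
    also have "\<dots> = u" using u' by (rule PiE_restrict)
    finally show "\<one>\<^bsub>R\<^esub> \<odot>\<^bsub>?M\<^esub> u = u" by (simp add: free_mod_def)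
  qed (simp_all add: free_mod_def restrict_PiE_iff c l_distr r_distr m_assoc cong: restrict_cong)
qed

text \<open>The \<open>R\<close>-linear extension of a right action on the basis \<open>\<Omega>\<close>: the coefficient of
  \<open>x\<close> in \<open>u g\<close> is the coefficient of \<open>x g\<inverse>\<close> in \<open>u\<close>.\<close>

definition free_act :: "('g, 'm) monoid_scheme \<Rightarrow> 'x set \<Rightarrow> ('g \<Rightarrow> 'x \<Rightarrow> 'x) \<Rightarrow> 'g \<Rightarrow>
    ('x \<Rightarrow> 'r) \<Rightarrow> ('x \<Rightarrow> 'r)" where
  "free_act G \<Omega> act g u = (\<lambda>x\<in>\<Omega>. u (act (inv\<^bsub>G\<^esub> g) x))"

definition basis_vec :: "('r, 'm) ring_scheme \<Rightarrow> 'x set \<Rightarrow> 'x \<Rightarrow> ('x \<Rightarrow> 'r)" where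
  "basis_vec R \<Omega> y = (\<lambda>x\<in>\<Omega>. if x = y then \<one>\<^bsub>R\<^esub> else \<zero>\<^bsub>R\<^esub>)"

lemma coset_act_closed:
  assumes "group G" "subgroup H G" "g \<in> carrier G" "A \<in> rcosets\<^bsub>G\<^esub> H"
  shows "coset_act G g A \<in> rcosets\<^bsub>G\<^esub> H"
proof -
  interpret group G by fact
  have H: "H \<subseteq> carrier G" using assms(2) by (rule subgroup.subset)
  obtain a where "a \<in> carrier G" "A = H #>\<^bsub>G\<^esub> a"
    using assms(4) by (auto simp: RCOSETS_def)
  then show ?thesis
    using H assms(3) by (simp add: coset_act_def coset_mult_assoc rcosetsI)
qed

lemma coset_act_one:
  assumes "group G" "subgroup H G" "A \<in> rcosets\<^bsub>G\<^esub> H"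
  shows "coset_act G \<one>\<^bsub>G\<^esub> A = A"
proof -
  have "A \<subseteq> carrier G" using group.rcosets_subset_PowG[OF assms(1,2)] assms(3) by auto
  then show ?thesis using assms by (simp add: coset_act_def group.coset_mult_one)
qed

lemma coset_act_mult:
  assumes "group G" "subgroup H G" "A \<in> rcosets\<^bsub>G\<^esub> H" "g \<in> carrier G" "h \<in> carrier G"
  shows "coset_act G (g \<otimes>\<^bsub>G\<^esub> h) A = coset_act G h (coset_act G g A)"
proof -
  have "A \<subseteq> carrier G" using group.rcosets_subset_PowG[OF assms(1,2)] assms(3) by auto
  then show ?thesis using assms by (simp add: coset_act_def group.coset_mult_assoc)
qed

lemma free_act_basis_vec:
  assumes "group G" "subgroup H G" "g \<in> carrier G" "A \<in> rcosets\<^bsub>G\<^esub> H"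
  shows "free_act G (rcosets\<^bsub>G\<^esub> H) (coset_act G) g (basis_vec R (rcosets\<^bsub>G\<^esub> H) A)
       = basis_vec R (rcosets\<^bsub>G\<^esub> H) (coset_act G g A)"
proof -
  interpret group G by fact
  have eq: "coset_act G (inv\<^bsub>G\<^esub> g) B = A \<longleftrightarrow> B = coset_act G g A"
    if B: "B \<in> rcosets\<^bsub>G\<^esub> H" for B
    using coset_act_mult[OF assms(1,2) B, of "inv\<^bsub>G\<^esub> g" g]
      coset_act_mult[OF assms(1,2,4), of g "inv\<^bsub>G\<^esub> g"]
      coset_act_one[OF assms(1,2) B] coset_act_one[OF assms(1,2,4)] assms(3)
    by auto
  show ?thesis
    using assms(3) eq coset_act_closed[OF assms(1,2), of "inv\<^bsub>G\<^esub> g"]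
    by (auto simp: free_act_def basis_vec_def fun_eq_iff)
qed

text \<open>A right \<open>R[G]\<close>-module is an \<open>R\<close>-module \<open>M\<close> with an \<open>R\<close>-linear right action \<open>\<rho>\<close> of
  \<open>G\<close>; the isomorphisms are the \<open>R\<close>-linear, \<open>G\<close>-equivariant bijections.\<close>

definition gmodule_isomorphic ::
    "('r, 'n) ring_scheme \<Rightarrow> ('g, 'm) monoid_scheme \<Rightarrow>
     ('r, 'a, 'k) module_scheme \<Rightarrow> ('g \<Rightarrow> 'a \<Rightarrow> 'a) \<Rightarrow>
     ('r, 'b, 'l) module_scheme \<Rightarrow> ('g \<Rightarrow> 'b \<Rightarrow> 'b) \<Rightarrow> bool" where
  "gmodule_isomorphic R G M \<rho> N \<sigma> \<longleftrightarrow>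
    (\<exists>T. bij_betw T (carrier M) (carrier N) \<and>
      (\<forall>u\<in>carrier M. \<forall>v\<in>carrier M. T (u \<oplus>\<^bsub>M\<^esub> v) = T u \<oplus>\<^bsub>N\<^esub> T v) \<and>
      (\<forall>r\<in>carrier R. \<forall>u\<in>carrier M. T (r \<odot>\<^bsub>M\<^esub> u) = r \<odot>\<^bsub>N\<^esub> T u) \<and>
      (\<forall>g\<in>carrier G. \<forall>u\<in>carrier M. T (\<rho> g u) = \<sigma> g (T u)))"

definition locally_integrally_equivalent ::
    "('g, 'm) monoid_scheme \<Rightarrow> 'g set \<Rightarrow> 'g set \<Rightarrow> bool" where
  "locally_integrally_equivalent G H1 H2 \<longleftrightarrow>
    (\<forall>p::nat. prime p \<longrightarrow>
      gmodule_isomorphic (padic_int p) G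
        (free_mod (padic_int p) (rcosets\<^bsub>G\<^esub> H1)) (free_act G (rcosets\<^bsub>G\<^esub> H1) (coset_act G))
        (free_mod (padic_int p) (rcosets\<^bsub>G\<^esub> H2)) (free_act G (rcosets\<^bsub>G\<^esub> H2) (coset_act G)))"

text \<open>HOL has no quantification over types inside a formula, so "there is a finite group"
  is read over one infinite element type, \<open>nat \<Rightarrow> nat\<close>. Nothing is lost: every finite group
  is isomorphic to a group of that type, for instance a group of permutations.\<close>

end

theory Submission
  imports Defs "HOL-Number_Theory.Cong" "HOL-Combinatorics.Permutations"
begin

text \<open>Fix an octad \<open>O\<close> of the binary Golay code and two points \<open>p, q\<close> of \<open>O\<close>. The stabilizer \<open>G\<close> of
  \<open>O\<close>, \<open>p\<close> and \<open>q\<close> in \<open>M\<^sub>2\<^sub>4\<close> is \<open>2\<^sup>4 : A\<^sub>6\<close>, acting on the 16 points off \<open>O\<close> by affine maps of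
  \<open>\<bbbF>\<^sub>2\<^sup>4\<close>. The octads that meet \<open>O\<close> in \<open>{i, p}\<close>, respectively in \<open>{i, q}\<close>, for one of the six other
  points \<open>i\<close> of \<open>O\<close>, cut out two families \<open>\<Omega>\<^sub>1, \<Omega>\<^sub>2\<close> of 96 subsets of size six of these 16
  points. The stabilizers of their members are isomorphic to \<open>A\<^sub>5\<close>; both actions are transitive with
  suborbits of lengths 1, 15, 20, 30, 30.

  The \<open>G\<close>-orbits on \<open>\<Omega>\<^sub>1 \<times> \<Omega>\<^sub>2\<close> are the fibres of \<open>\<bar>X \<inter> Y\<bar> \<in> {0, 1, 2, 3, 4}\<close>, none of which is
  the graph of a bijection, so the \<open>G\<close>-sets are not isomorphic. Let \<open>A\<^sub>n\<close> be the \<open>0/1\<close> matrix of the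
  relation \<open>\<bar>X \<inter> Y\<bar> = n\<close>. Then \<open>(A\<^sub>3 - A\<^sub>1) (A\<^sub>3 - A\<^sub>1)\<^sup>T = 16 I\<close> and
  \<open>(A\<^sub>1 - A\<^sub>4) (- 4 A\<^sub>0 - 3 A\<^sub>1 + A\<^sub>2 + 2 A\<^sub>3 - 3 A\<^sub>4)\<^sup>T = 27 I\<close>. Since 16 and 27 are coprime, for
  every prime one of the intertwiners \<open>A\<^sub>3 - A\<^sub>1\<close> and \<open>A\<^sub>1 - A\<^sub>4\<close> is invertible over the \<open>p\<close>-adic
  integers.\<close>

section \<open>Right actions\<close>

locale right_action = group G for G (structure) +
  fixes \<Omega> :: "'x set" and act :: "'a \<Rightarrow> 'x \<Rightarrow> 'x"
  assumes act_closed: "g \<in> carrier G \<Longrightarrow> x \<in> \<Omega> \<Longrightarrow> act g x \<in> \<Omega>"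
    and act_one: "x \<in> \<Omega> \<Longrightarrow> act \<one> x = x"
    and act_mult: "g \<in> carrier G \<Longrightarrow> h \<in> carrier G \<Longrightarrow> x \<in> \<Omega> \<Longrightarrow> act (g \<otimes> h) x = act h (act g x)"
begin

lemma act_inv_act: "g \<in> carrier G \<Longrightarrow> x \<in> \<Omega> \<Longrightarrow> act (inv g) (act g x) = x"
  using act_mult[of g "inv g" x] act_one by simp

lemma act_act_inv: "g \<in> carrier G \<Longrightarrow> x \<in> \<Omega> \<Longrightarrow> act g (act (inv g) x) = x"
  using act_mult[of "inv g" g x] act_one by simp

lemma bij_betw_act: "g \<in> carrier G \<Longrightarrow> bij_betw (act g) \<Omega> \<Omega>"
  by (rule bij_betw_byWitness[where f' = "act (inv g)"])
    (auto simp: act_inv_act act_act_inv act_closed)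

lemma subgroup_stabilizer: "x \<in> \<Omega> \<Longrightarrow> subgroup (stabilizer G act x) G"
  by (rule subgroupI)
    (use act_one act_mult act_inv_act one_closed in \<open>auto simp: stabilizer_def, metis\<close>)

text \<open>Orbit-stabilizer theorem. In \<open>h \<otimes> g\<close> the factor \<open>h\<close>
  acts first, so the image of \<open>x\<close> is constant on right cosets of the stabilizer, and
  any chosen element of a coset computes it.\<close>

lemma rcosets_stabilizer_isomorphic:
  assumes x: "x \<in> \<Omega>" and trans: "\<And>y. y \<in> \<Omega> \<Longrightarrow> \<exists>g\<in>carrier G. act g x = y"
  shows "gset_isomorphic G (rcosets (stabilizer G act x)) (coset_act G) \<Omega> act"
proof -
  let ?S = "stabilizer G act x"
  define f where "f A = act (SOME g. g \<in> A) x" for A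
  have S: "subgroup ?S G" by (rule subgroup_stabilizer[OF x])
  have f: "f (?S #> g) = act g x" if g: "g \<in> carrier G" for g
  proof -
    have "(SOME k. k \<in> ?S #> g) \<in> ?S #> g"
      using rcos_self[OF g S] by (rule someI)
    then obtain h where "h \<in> ?S" "(SOME k. k \<in> ?S #> g) = h \<otimes> g"
      by (auto simp: r_coset_def)
    then show ?thesis using g x by (auto simp: f_def stabilizer_def act_mult)
  qed
  have "inj_on f (rcosets ?S)"
  proof (rule inj_onI)
    fix A B assume "A \<in> rcosets ?S" "B \<in> rcosets ?S" and eq: "f A = f B"
    then obtain g h where g: "g \<in> carrier G" "A = ?S #> g" and h: "h \<in> carrier G" "B = ?S #> h"
      by (auto simp: RCOSETS_def)
    have "act h x = act g x" using eq g h f by simp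
    then have "act (h \<otimes> inv g) x = x" using g h x by (simp add: act_mult act_inv_act)
    then have "h \<otimes> inv g \<in> ?S" using g h by (simp add: stabilizer_def)
    then have "h \<otimes> inv g \<otimes> g \<in> ?S #> g" by (auto simp: r_coset_def)
    then have "h \<in> ?S #> g" using g h by (simp add: m_assoc)
    then show "A = B" using repr_independence[OF _ g(1) S] g h by blast
  qed
  moreover have "f ` (rcosets ?S) = \<Omega>"
  proof (intro equalityI subsetI)
    fix y assume "y \<in> \<Omega>"
    then obtain g where "g \<in> carrier G" "act g x = y" using trans by blast
    then show "y \<in> f ` (rcosets ?S)"
      using f by (auto simp: RCOSETS_def intro!: image_eqI[where x = "?S #> g"])
  qed (auto simp: RCOSETS_def f act_closed x)
  moreover have "f (coset_act G g A) = act g (f A)" if "g \<in> carrier G" "A \<in> rcosets ?S" for g A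
    using that x f act_mult subgroup.subset[OF S]
    by (auto simp: RCOSETS_def coset_act_def coset_mult_assoc)
  ultimately show ?thesis
    by (auto simp: gset_isomorphic_def bij_betw_def)
qed

text \<open>If the fibres of \<open>F\<close> separate the representatives of the suborbits, then they
  are the orbitals.\<close>

lemma action_rank_eq_card_suborbits:
  assumes x: "x \<in> \<Omega>" and trans: "\<And>y. y \<in> \<Omega> \<Longrightarrow> \<exists>g\<in>carrier G. act g x = y"
    and R: "R \<subseteq> \<Omega>" "\<And>y. y \<in> \<Omega> \<Longrightarrow> \<exists>r\<in>R. \<exists>h\<in>stabilizer G act x. act h r = y"
    and F: "\<And>g y z. g \<in> carrier G \<Longrightarrow> y \<in> \<Omega> \<Longrightarrow> z \<in> \<Omega> \<Longrightarrow> F (act g y) (act g z) = F y z"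
    and inj: "inj_on (F x) R"
  shows "action_rank G \<Omega> act = card R"
proof -
  let ?act = "\<lambda>g (x, y). (act g x, act g y)"
  let ?o = "\<lambda>r. orbit G ?act (x, r)"
  have eq: "orbit G ?act (act g x, act g y) = orbit G ?act (x, y)"
    if g: "g \<in> carrier G" and y: "y \<in> \<Omega>" for g y
  proof (intro equalityI subsetI)
    fix q assume "q \<in> orbit G ?act (act g x, act g y)"
    then obtain h where "h \<in> carrier G" "q = ?act (g \<otimes> h) (x, y)"
      using g x y by (auto simp: orbit_def act_mult)
    then show "q \<in> orbit G ?act (x, y)" using g unfolding orbit_def by blast
  next
    fix q assume "q \<in> orbit G ?act (x, y)"
    then obtain h where h: "h \<in> carrier G" "q = ?act h (x, y)" by (auto simp: orbit_def)
    then have "q = ?act (inv g \<otimes> h) (act g x, act g y)"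
      using g x y by (simp add: act_mult act_closed act_inv_act)
    then show "q \<in> orbit G ?act (act g x, act g y)"
      using g h(1) unfolding orbit_def by (intro CollectI exI[of _ "inv g \<otimes> h"]) simp
  qed
  have "inj_on ?o R"
  proof (rule inj_onI)
    fix r s assume r: "r \<in> R" and s: "s \<in> R" and rs: "?o r = ?o s"
    have "(act \<one> x, act \<one> r) \<in> ?o r" by (auto simp: orbit_def)
    then have "(x, r) \<in> ?o s" using x r R(1) act_one unfolding rs by auto
    then obtain g where "g \<in> carrier G" "act g x = x" "act g s = r"
      by (auto simp: orbit_def)
    then have "F x r = F x s" using F[of g x s] x s R(1) by auto
    then show "r = s" using inj r s by (auto dest: inj_onD)
  qed
  moreover have "?o ` R = orbits G (\<Omega> \<times> \<Omega>) ?act"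
  proof (intro equalityI subsetI)
    fix B assume "B \<in> orbits G (\<Omega> \<times> \<Omega>) ?act"
    then obtain y z where yz: "y \<in> \<Omega>" "z \<in> \<Omega>" "B = orbit G ?act (y, z)"
      by (auto simp: orbits_def)
    \<comment> \<open>\<open>inv g\<close> brings the first coordinate back to \<open>x\<close>, and
      the stabilizer of \<open>x\<close> links the second one to a representative; then
      \<open>h \<otimes> g\<close> carries \<open>(x, r)\<close> to \<open>(y, z)\<close>.\<close>
    obtain g where g: "g \<in> carrier G" "act g x = y" using trans yz by blast
    obtain r h where r: "r \<in> R" and h: "h \<in> carrier G" "act h x = x" "act h r = act (inv g) z"
      using R(2)[of "act (inv g) z"] g yz by (auto simp: stabilizer_def act_closed)
    have "act (h \<otimes> g) x = y" "act (h \<otimes> g) r = z"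
      using g h r R(1) x yz by (auto simp: act_mult act_act_inv subset_iff)
    then have "B = ?o r" using eq[of "h \<otimes> g" r] g h r R(1) yz by auto
    then show "B \<in> ?o ` R" using r by blast
  qed (use x R(1) in \<open>auto simp: orbits_def\<close>)
  ultimately show ?thesis
    using card_image[of ?o R] by (simp add: action_rank_def)
qed

end

section \<open>Isomorphisms of G-sets\<close>

lemma right_action_rcosets:
  assumes "group G" "subgroup H G"
  shows "right_action G (rcosets\<^bsub>G\<^esub> H) (coset_act G)"
  using assms by (intro right_action.intro right_action_axioms.intro)
    (simp_all add: coset_act_closed coset_act_one coset_act_mult)

text \<open>\<open>map_prod f f\<close> carries orbitals onto orbitals, and taking images under it
  is injective on subsets of \<open>\<Omega>1 \<times> \<Omega>1\<close>. This lets the rank of a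
  coset space be computed on a concrete G-set.\<close>

lemma action_rank_gset_isomorphic:
  assumes iso: "gset_isomorphic G \<Omega>1 act1 \<Omega>2 act2"
    and act1: "right_action G \<Omega>1 act1"
  shows "action_rank G \<Omega>1 act1 = action_rank G \<Omega>2 act2"
proof -
  interpret right_action G \<Omega>1 act1 by fact
  let ?a1 = "\<lambda>g (x, y). (act1 g x, act1 g y)" and ?a2 = "\<lambda>g (x, y). (act2 g x, act2 g y)"
  obtain f where f: "bij_betw f \<Omega>1 \<Omega>2"
      "\<And>g x. g \<in> carrier G \<Longrightarrow> x \<in> \<Omega>1 \<Longrightarrow> f (act1 g x) = act2 g (f x)"
    using iso by (auto simp: gset_isomorphic_def)
  let ?F = "map_prod f f"
  have orb: "?F ` orbit G ?a1 (x, y) = orbit G ?a2 (f x, f y)" if "x \<in> \<Omega>1" "y \<in> \<Omega>1" for x y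
  proof -
    have "orbit G ?a1 (x, y) = (\<lambda>g. (act1 g x, act1 g y)) ` carrier G"
      "orbit G ?a2 (f x, f y) = (\<lambda>g. (act2 g (f x), act2 g (f y))) ` carrier G"
      by (auto simp: orbit_def)
    then show ?thesis
      using that f(2) by (simp add: image_image cong: image_cong)
  qed
  have sub: "orbits G (\<Omega>1 \<times> \<Omega>1) ?a1 \<subseteq> Pow (\<Omega>1 \<times> \<Omega>1)"
    by (auto simp: orbits_def orbit_def act_closed)
  have "inj_on ?F (\<Omega>1 \<times> \<Omega>1)"
    by (intro map_prod_inj_on bij_betw_imp_inj_on[OF f(1)])
  then have "inj_on ((`) ?F) (orbits G (\<Omega>1 \<times> \<Omega>1) ?a1)"
    by (rule inj_on_subset[OF inj_on_image_Pow sub])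
  moreover have "(`) ?F ` orbits G (\<Omega>1 \<times> \<Omega>1) ?a1 = orbits G (\<Omega>2 \<times> \<Omega>2) ?a2"
  proof -
    have "(`) ?F ` orbits G (\<Omega>1 \<times> \<Omega>1) ?a1 = (\<lambda>(x, y). orbit G ?a2 (f x, f y)) ` (\<Omega>1 \<times> \<Omega>1)"
    proof -
      have orbits: "orbits G (\<Omega>1 \<times> \<Omega>1) ?a1 = orbit G ?a1 ` (\<Omega>1 \<times> \<Omega>1)" by (auto simp: orbits_def)
      show ?thesis unfolding orbits image_image by (rule image_cong[OF refl]) (clarsimp simp: orb)
    qed
    also have "\<dots> = orbit G ?a2 ` (?F ` (\<Omega>1 \<times> \<Omega>1))"
      unfolding image_image by (intro image_cong) auto
    also have "?F ` (\<Omega>1 \<times> \<Omega>1) = \<Omega>2 \<times> \<Omega>2"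
      using f(1) by (simp add: bij_betw_def map_prod_surj_on)
    finally show ?thesis by (auto simp: orbits_def)
  qed
  ultimately show ?thesis
    using card_image[of "(`) ?F" "orbits G (\<Omega>1 \<times> \<Omega>1) ?a1"] by (simp add: action_rank_def)
qed

lemma gset_isomorphic_sym:
  assumes iso: "gset_isomorphic G \<Omega>1 act1 \<Omega>2 act2" and act1: "right_action G \<Omega>1 act1"
  shows "gset_isomorphic G \<Omega>2 act2 \<Omega>1 act1"
proof -
  interpret right_action G \<Omega>1 act1 by fact
  obtain f where f: "bij_betw f \<Omega>1 \<Omega>2"
      "\<And>g x. g \<in> carrier G \<Longrightarrow> x \<in> \<Omega>1 \<Longrightarrow> f (act1 g x) = act2 g (f x)"
    using iso by (auto simp: gset_isomorphic_def)
  have "the_inv_into \<Omega>1 f (act2 g y) = act1 g (the_inv_into \<Omega>1 f y)"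
    if g: "g \<in> carrier G" and y: "y \<in> \<Omega>2" for g y
  proof -
    obtain x where "x \<in> \<Omega>1" "y = f x" using f(1) y unfolding bij_betw_def by blast
    then show ?thesis
      using f g act_closed by (simp add: bij_betw_def the_inv_into_f_f flip: f(2))
  qed
  then show ?thesis
    using bij_betw_the_inv_into[OF f(1)] by (auto simp: gset_isomorphic_def)
qed

lemma gset_isomorphic_trans:
  assumes "gset_isomorphic G \<Omega>1 act1 \<Omega>2 act2" "gset_isomorphic G \<Omega>2 act2 \<Omega>3 act3"
  shows "gset_isomorphic G \<Omega>1 act1 \<Omega>3 act3"
proof -
  obtain f h where "bij_betw f \<Omega>1 \<Omega>2" "bij_betw h \<Omega>2 \<Omega>3"
    and "\<And>g x. g \<in> carrier G \<Longrightarrow> x \<in> \<Omega>1 \<Longrightarrow> f (act1 g x) = act2 g (f x)"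
    and "\<And>g x. g \<in> carrier G \<Longrightarrow> x \<in> \<Omega>2 \<Longrightarrow> h (act2 g x) = act3 g (h x)"
    using assms by (auto simp: gset_isomorphic_def)
  then show ?thesis
    by (auto simp: gset_isomorphic_def bij_betw_apply intro!: exI[of _ "h \<circ> f"] bij_betw_trans)
qed

section \<open>Intertwining matrices over the p-adic integers\<close>

lemma free_mod_padic_int_cong:
  assumes "u \<in> carrier (free_mod (padic_int p) \<Omega>)" "x \<in> \<Omega>"
  shows "u x n \<in> {0..<int p ^ n}" "u x n mod int p ^ n = u x n" "u x (Suc n) mod int p ^ n = u x n"
proof -
  have "u x \<in> carrier (padic_int p)" using assms by (auto simp: free_mod_def)
  then show "u x n \<in> {0..<int p ^ n}" "u x (Suc n) mod int p ^ n = u x n"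
    by (auto simp: padic_int_def)
  then show "u x n mod int p ^ n = u x n" by simp
qed

text \<open>Coherence is asked only modulo \<open>p ^ n\<close>, so vectors can be given by integer
  formulas that are reduced at the end.\<close>

lemma padic_vectorI:
  assumes "p > 0" "\<And>x n. x \<in> \<Omega> \<Longrightarrow> f x (Suc n) mod int p ^ n = f x n mod int p ^ n"
  shows "(\<lambda>x\<in>\<Omega>. \<lambda>n. f x n mod int p ^ n) \<in> carrier (free_mod (padic_int p) \<Omega>)"
  using assms by (simp add: free_mod_def padic_int_def mod_power_Suc_mod restrict_PiE_iff del: power_Suc)

lemma free_mod_extensional: "u \<in> carrier (free_mod R \<Omega>) \<Longrightarrow> u \<in> extensional \<Omega>"
  by (auto simp: free_mod_def PiE_def)

text \<open>Interchanging the sums collapses the inner matrix product to \<open>m\<close> times the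
  identity.\<close>

lemma sum_mult_delta_left:
  fixes K L :: "_ \<Rightarrow> _ \<Rightarrow> int"
  assumes "finite A" "z \<in> A" "\<And>x. x \<in> A \<Longrightarrow> (\<Sum>y\<in>B. K x y * L y z) = (if x = z then m else 0)"
  shows "(\<Sum>y\<in>B. L y z * (\<Sum>x\<in>A. K x y * v x)) = m * v z"
proof -
  have "(\<Sum>y\<in>B. L y z * (\<Sum>x\<in>A. K x y * v x)) = (\<Sum>y\<in>B. \<Sum>x\<in>A. (K x y * L y z) * v x)"
    by (simp add: sum_distrib_left mult_ac)
  also have "\<dots> = (\<Sum>x\<in>A. \<Sum>y\<in>B. (K x y * L y z) * v x)" by (rule sum.swap)
  also have "\<dots> = (\<Sum>x\<in>A. (\<Sum>y\<in>B. K x y * L y z) * v x)"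
    by (simp add: sum_distrib_right)
  also have "\<dots> = (\<Sum>x\<in>A. if x = z then m * v x else 0)"
    by (intro sum.cong) (simp_all add: assms(3))
  finally show ?thesis using assms(1,2) by simp
qed

text \<open>Lets reductions inside a matrix-vector product be dropped under an outer
  reduction.\<close>

lemma mod_mult_sum_mod: "(c * (\<Sum>x\<in>A. k x * (v x mod q))) mod q = (c * (\<Sum>x\<in>A. k x * v x)) mod (q::int)"
proof -
  have "[(\<Sum>x\<in>A. k x * (v x mod q)) = (\<Sum>x\<in>A. k x * v x)] (mod q)"
    by (intro cong_sum) (simp add: cong_def mod_mult_right_eq)
  then show ?thesis by (auto simp: cong_def intro: mod_mult_cong)
qed

text \<open>Each level is solved independently; coherence is automatic because inverses modulo
  \<open>p ^ n\<close> are unique. The integers \<open>c n\<close> approximate the p-adic number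
  \<open>1/m\<close>.\<close>

lemma padic_unit_inverse:
  assumes "coprime m (int p)"
  obtains c where "\<And>n. [c n * m = 1] (mod int p ^ n)" "\<And>n. [c (Suc n) = c n] (mod int p ^ n)"
proof -
  have cop: "coprime m (int p ^ n)" for n using assms by simp
  then have "\<forall>n. \<exists>x. [m * x = 1] (mod int p ^ n)"
    by (meson cong_solve_coprime_int)
  then obtain c where c: "\<And>n. [m * c n = 1] (mod int p ^ n)" by metis
  have "[c (Suc n) = c n] (mod int p ^ n)" for n
  proof -
    have "[m * c (Suc n) = 1] (mod int p ^ n)"
      using c[of "Suc n"] by (rule cong_dvd_modulus) (simp add: le_imp_power_dvd)
    then have "[m * c (Suc n) = m * c n] (mod int p ^ n)"
      using c[of n] by (metis cong_sym cong_trans)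
    then show ?thesis using cop cong_mult_lcancel by blast
  qed
  with c show ?thesis by (intro that[of c]) (simp_all add: mult.commute)
qed

text \<open>\<open>K\<close> defines the map \<open>T\<close>, and \<open>L\<close> divided by the
  unit \<open>m\<close> defines its inverse \<open>S\<close>; the two product identities give both
  composites. Invariance of \<open>K\<close> makes \<open>T\<close> equivariant.\<close>

lemma gmodule_isomorphic_padic_matrix:
  fixes K :: "'x \<Rightarrow> 'y \<Rightarrow> int" and L :: "'y \<Rightarrow> 'x \<Rightarrow> int"
  assumes act1: "right_action G \<Omega>1 act1" and act2: "right_action G \<Omega>2 act2"
    and fin: "finite \<Omega>1" "finite \<Omega>2" and p: "p > 0" and m: "coprime m (int p)"
    and K: "\<And>g x y. g \<in> carrier G \<Longrightarrow> x \<in> \<Omega>1 \<Longrightarrow> y \<in> \<Omega>2 \<Longrightarrow> K (act1 g x) (act2 g y) = K x y"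
    and KL: "\<And>x z. x \<in> \<Omega>1 \<Longrightarrow> z \<in> \<Omega>1 \<Longrightarrow> (\<Sum>y\<in>\<Omega>2. K x y * L y z) = (if x = z then m else 0)"
    and LK: "\<And>y z. y \<in> \<Omega>2 \<Longrightarrow> z \<in> \<Omega>2 \<Longrightarrow> (\<Sum>x\<in>\<Omega>1. L y x * K x z) = (if y = z then m else 0)"
  shows "gmodule_isomorphic (padic_int p) G
    (free_mod (padic_int p) \<Omega>1) (free_act G \<Omega>1 act1) (free_mod (padic_int p) \<Omega>2) (free_act G \<Omega>2 act2)"
proof -
  interpret A1: right_action G \<Omega>1 act1 by fact
  interpret A2: right_action G \<Omega>2 act2 by fact
  let ?M = "\<lambda>\<Omega>. free_mod (padic_int p) \<Omega>"
  obtain c where c: "\<And>n. [c n * m = 1] (mod int p ^ n)" "\<And>n. [c (Suc n) = c n] (mod int p ^ n)"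
    using padic_unit_inverse[OF m] by blast
  have c1: "(c n * (m * a)) mod int p ^ n = a mod int p ^ n" for n a
    using cong_mult[OF c(1)[of n] cong_refl[of a]] by (simp add: cong_def mult.assoc)
  define T where "T u = (\<lambda>y\<in>\<Omega>2. \<lambda>n. (\<Sum>x\<in>\<Omega>1. K x y * u x n) mod int p ^ n)" for u
  define S where "S v = (\<lambda>x\<in>\<Omega>1. \<lambda>n. (c n * (\<Sum>y\<in>\<Omega>2. L y x * v y n)) mod int p ^ n)" for v
  have T_mem: "T u \<in> carrier (?M \<Omega>2)" if u: "u \<in> carrier (?M \<Omega>1)" for u
    unfolding T_def
  proof (rule padic_vectorI[OF p])
    fix y n
    show "(\<Sum>x\<in>\<Omega>1. K x y * u x (Suc n)) mod int p ^ n = (\<Sum>x\<in>\<Omega>1. K x y * u x n) mod int p ^ n"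
      using mod_mult_sum_mod[of 1 "\<lambda>x. K x y" "\<lambda>x. u x (Suc n)" "int p ^ n" \<Omega>1]
      by (simp add: free_mod_padic_int_cong(3)[OF u])
  qed
  have S_mem: "S v \<in> carrier (?M \<Omega>1)" if v: "v \<in> carrier (?M \<Omega>2)" for v
    unfolding S_def
  proof (rule padic_vectorI[OF p])
    fix x n
    have "(c (Suc n) * (\<Sum>y\<in>\<Omega>2. L y x * v y (Suc n))) mod int p ^ n
        = (c (Suc n) * (\<Sum>y\<in>\<Omega>2. L y x * v y n)) mod int p ^ n"
      using mod_mult_sum_mod[of "c (Suc n)" "\<lambda>y. L y x" "\<lambda>y. v y (Suc n)" "int p ^ n" \<Omega>2]
      by (simp add: free_mod_padic_int_cong(3)[OF v])
    also have "\<dots> = (c n * (\<Sum>y\<in>\<Omega>2. L y x * v y n)) mod int p ^ n"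
      using c(2)[of n] by (auto simp: cong_def intro: mod_mult_cong)
    finally show "(c (Suc n) * (\<Sum>y\<in>\<Omega>2. L y x * v y (Suc n))) mod int p ^ n
        = (c n * (\<Sum>y\<in>\<Omega>2. L y x * v y n)) mod int p ^ n" .
  qed
  have ST: "S (T u) = u" if u: "u \<in> carrier (?M \<Omega>1)" for u
  proof (rule extensionalityI)
    fix z assume z: "z \<in> \<Omega>1"
    show "S (T u) z = u z"
    proof
      fix n
      have "S (T u) z n = (c n * (\<Sum>y\<in>\<Omega>2. L y z * (\<Sum>x\<in>\<Omega>1. K x y * u x n))) mod int p ^ n"
        using z mod_mult_sum_mod[of "c n" "\<lambda>y. L y z" "\<lambda>y. \<Sum>x\<in>\<Omega>1. K x y * u x n" "int p ^ n" \<Omega>2]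
        by (simp add: S_def T_def)
      also have "\<dots> = u z n"
        using z sum_mult_delta_left[where K = K and L = L, OF fin(1) z KL[OF _ z]] free_mod_padic_int_cong(2)[OF u z]
        by (simp add: c1)
      finally show "S (T u) z n = u z n" .
    qed
  qed (use S_mem[OF T_mem[OF u]] u in \<open>auto intro: free_mod_extensional\<close>)
  have TS: "T (S v) = v" if v: "v \<in> carrier (?M \<Omega>2)" for v
  proof (rule extensionalityI)
    fix z assume z: "z \<in> \<Omega>2"
    show "T (S v) z = v z"
    proof
      fix n
      have "T (S v) z n = (\<Sum>x\<in>\<Omega>1. K x z * (c n * (\<Sum>y\<in>\<Omega>2. L y x * v y n))) mod int p ^ n"
        using z mod_mult_sum_mod[of 1 "\<lambda>x. K x z" "\<lambda>x. c n * (\<Sum>y\<in>\<Omega>2. L y x * v y n)" "int p ^ n" \<Omega>1]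
        by (simp add: S_def T_def)
      also have "(\<Sum>x\<in>\<Omega>1. K x z * (c n * (\<Sum>y\<in>\<Omega>2. L y x * v y n)))
          = c n * (\<Sum>x\<in>\<Omega>1. K x z * (\<Sum>y\<in>\<Omega>2. L y x * v y n))"
        by (simp add: sum_distrib_left mult_ac)
      also have "\<dots> mod int p ^ n = v z n"
        using z sum_mult_delta_left[where K = L and L = K, OF fin(2) z LK[OF _ z]] free_mod_padic_int_cong(2)[OF v z]
        by (simp add: c1)
      finally show "T (S v) z n = v z n" .
    qed
  qed (use T_mem[OF S_mem[OF v]] v in \<open>auto intro: free_mod_extensional\<close>)
  have bij: "bij_betw T (carrier (?M \<Omega>1)) (carrier (?M \<Omega>2))"
    by (rule bij_betw_byWitness[where f' = S]) (auto simp: ST TS T_mem S_mem)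
  have add: "T (u \<oplus>\<^bsub>?M \<Omega>1\<^esub> v) = T u \<oplus>\<^bsub>?M \<Omega>2\<^esub> T v" for u v
  proof -
    have "(\<Sum>x\<in>\<Omega>1. K x y * ((u x n + v x n) mod int p ^ n)) mod int p ^ n
        = ((\<Sum>x\<in>\<Omega>1. K x y * u x n) mod int p ^ n + (\<Sum>x\<in>\<Omega>1. K x y * v x n) mod int p ^ n) mod int p ^ n"
      for y n
      using mod_mult_sum_mod[of 1 "\<lambda>x. K x y" "\<lambda>x. u x n + v x n" "int p ^ n" \<Omega>1]
      by (simp add: mod_add_eq distrib_left sum.distrib)
    then show ?thesis
      by (auto simp: T_def free_mod_def padic_int_def cong: sum.cong restrict_cong)
  qed
  have smult: "T (r \<odot>\<^bsub>?M \<Omega>1\<^esub> u) = r \<odot>\<^bsub>?M \<Omega>2\<^esub> T u" for r u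
  proof -
    have "(\<Sum>x\<in>\<Omega>1. K x y * ((r n * u x n) mod int p ^ n)) mod int p ^ n
        = (r n * ((\<Sum>x\<in>\<Omega>1. K x y * u x n) mod int p ^ n)) mod int p ^ n" for y n
      using mod_mult_sum_mod[of 1 "\<lambda>x. K x y" "\<lambda>x. r n * u x n" "int p ^ n" \<Omega>1]
      by (simp add: mod_mult_right_eq sum_distrib_left mult_ac)
    then show ?thesis
      by (auto simp: T_def free_mod_def padic_int_def cong: sum.cong restrict_cong)
  qed
  have equiv: "T (free_act G \<Omega>1 act1 g u) = free_act G \<Omega>2 act2 g (T u)"
    if g: "g \<in> carrier G" for g u
  proof -
    have "(\<Sum>x\<in>\<Omega>1. K x y * u (act1 (inv\<^bsub>G\<^esub> g) x) n) = (\<Sum>x\<in>\<Omega>1. K x (act2 (inv\<^bsub>G\<^esub> g) y) * u x n)"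
      if y: "y \<in> \<Omega>2" for y n
    proof -
      \<comment> \<open>Coefficients of a translated vector are read at \<open>inv g\<close>, so the
        sum is reindexed along \<open>inv g\<close> before invariance of \<open>K\<close>
        applies.\<close>
      have "(\<Sum>x\<in>\<Omega>1. K x (act2 (inv\<^bsub>G\<^esub> g) y) * u x n)
          = (\<Sum>x\<in>\<Omega>1. K (act1 (inv\<^bsub>G\<^esub> g) x) (act2 (inv\<^bsub>G\<^esub> g) y) * u (act1 (inv\<^bsub>G\<^esub> g) x) n)"
        by (rule sum.reindex_bij_betw[symmetric, OF A1.bij_betw_act]) (use g in simp)
      then show ?thesis using K[of "inv\<^bsub>G\<^esub> g" _ y] g y by simp
    qed
    then show ?thesis
      using g A2.act_closed[of "inv\<^bsub>G\<^esub> g"]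
      by (auto simp: T_def free_act_def cong: sum.cong restrict_cong)
  qed
  show ?thesis
    unfolding gmodule_isomorphic_def using bij add smult equiv by (intro exI[of _ T]) simp
qed

section \<open>Two families of 96 six-element sets\<close>

text \<open>Points off the octad are numbered by the binary expansion of vectors of \<open>\<bbbF>\<^sub>2\<^sup>4\<close>, so \<open>xor\<close> is
  vector addition. Each translation class of \<open>\<Omega>\<^sub>1\<close> has one entry in \<open>base_sets\<close>; the first one
  is an affine frame with the sum of its points, the others form an orbit of \<open>perm_a\<close>.\<close>

definition base_sets :: "nat list list" where
  "base_sets = [[0,1,2,4,8,15], [0,1,2,6,9,12], [0,2,4,7,12,13], [0,4,5,7,8,14],
    [0,3,8,10,14,15], [0,1,3,6,11,15]]"

definition vectors :: "nat list" where
  "vectors = [0,1,2,3,4,5,6,7,8,9,10,11,12,13,14,15]"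

text \<open>The stabilizer \<open>PSL(2,5)\<close> of \<open>{0, 1, 2, 4, 8, 15}\<close> is generated by \<open>perm_a\<close> and \<open>perm_b\<close>:
  with 0 as \<open>\<infinity>\<close> and 1, 2, 4, 8, 15 as \<open>0, \<dots>, 4 \<in> \<bbbF>\<^sub>5\<close>, they are \<open>z \<mapsto> z + 1\<close> and \<open>z \<mapsto> - 1/z\<close>.
  Together with \<open>perm_c\<close> they act transitively on \<open>\<Omega>\<^sub>1\<close>. The transvection \<open>perm_t\<close> interchanges
  \<open>\<Omega>\<^sub>1\<close> and \<open>\<Omega>\<^sub>2\<close>.\<close>

definition perm_a :: "nat list" where "perm_a = [0,2,4,6,8,10,12,14,15,13,11,9,7,5,3,1]"
definition perm_b :: "nat list" where "perm_b = [1,0,15,14,4,5,10,11,8,9,6,7,13,12,3,2]"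
definition perm_c :: "nat list" where "perm_c = [0,1,2,3,6,7,4,5,9,8,11,10,15,14,13,12]"
definition perm_t :: "nat list" where "perm_t = [0,1,2,3,4,5,6,7,10,11,8,9,14,15,12,13]"

definition perm_of :: "nat list \<Rightarrow> nat \<Rightarrow> nat" where
  "perm_of l x = (if x < length l then l ! x else x)"

text \<open>Members of the families are kept as increasing lists, which turns equality of sets into
  equality of lists; hence the sorting.\<close>

definition apply_perm :: "nat list \<Rightarrow> nat list \<Rightarrow> nat list" where
  "apply_perm l X = sort (map ((!) l) X)"

definition family1 :: "nat list list" where
  "family1 = concat (map (\<lambda>X. map (\<lambda>v. sort (map (xor v) X)) vectors) base_sets)"

definition family2 :: "nat list list" where
  "family2 = map (apply_perm perm_t) family1"

definition Omega1 :: "nat set set" where "Omega1 = set ` set family1"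
definition Omega2 :: "nat set set" where "Omega2 = set ` set family2"

section \<open>Evaluation of the explicit families\<close>

lemma apply_perm_simps:
  "apply_perm l [] = []"
  "apply_perm l (x # xs) = insort (l ! x) (apply_perm l xs)"
  by (simp_all add: apply_perm_def)

text \<open>Used in place of \<open>list.set\<close>, these rules decide membership entry by entry
  without building nested \<open>insert\<close> terms.\<close>

lemma set_Cons_simps:
  "x \<in> set [] \<longleftrightarrow> False"
  "x \<in> set (y # ys) \<longleftrightarrow> x = y \<or> x \<in> set ys"
  "set [] \<subseteq> A \<longleftrightarrow> True"
  "set (y # ys) \<subseteq> A \<longleftrightarrow> y \<in> A \<and> set ys \<subseteq> A"
  by auto

text \<open>Here and below, \<open>One_nat_def\<close> would turn numerals into successor terms, on which the bitwise
  operations and comparisons no longer simplify.\<close>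

schematic_goal family1_eq: "family1 = ?xs"
  by (simp add: family1_def base_sets_def vectors_def del: One_nat_def)

schematic_goal family2_eq: "family2 = ?xs"
  by (simp add: family2_def family1_eq apply_perm_simps perm_t_def del: One_nat_def)

lemma family1_sorted: "\<forall>X\<in>set family1. sorted_wrt (<) X"
  by (simp add: family1_eq del: One_nat_def)

lemma family2_sorted: "\<forall>X\<in>set family2. sorted_wrt (<) X"
  by (simp add: family2_eq del: One_nat_def)

lemma distinct_family2: "distinct family2"
  by (simp add: family2_eq del: One_nat_def)

lemma family1_less: "\<forall>X\<in>set family1. \<forall>x\<in>set X. x < 16"
  by (simp add: family1_eq del: One_nat_def)

lemma family2_less: "\<forall>X\<in>set family2. \<forall>x\<in>set X. x < 16"
  by (simp add: family2_eq del: One_nat_def)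

lemma perms_preserve_family1:
  "set (map (apply_perm perm_a) family1) \<subseteq> set family1"
  "set (map (apply_perm perm_b) family1) \<subseteq> set family1"
  "set (map (apply_perm perm_c) family1) \<subseteq> set family1"
  by (simp_all add: family1_eq apply_perm_simps perm_a_def perm_b_def perm_c_def set_Cons_simps del: One_nat_def list.set)

lemma perms_preserve_family2:
  "set (map (apply_perm perm_a) family2) \<subseteq> set family2"
  "set (map (apply_perm perm_b) family2) \<subseteq> set family2"
  "set (map (apply_perm perm_c) family2) \<subseteq> set family2"
  by (simp_all add: family2_eq apply_perm_simps perm_a_def perm_b_def perm_c_def set_Cons_simps del: One_nat_def list.set)

section \<open>Suborbits as walks\<close>

fun walk :: "nat list list \<Rightarrow> nat list \<Rightarrow> nat list list" where
  "walk [] X = [X]"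
| "walk (l # ls) X = X # walk ls (apply_perm l X)"

definition base_point :: "nat list" where "base_point = [0,1,2,4,8,15]"

text \<open>Representatives of the suborbits, each with a Hamiltonian path through its suborbit in the
  Schreier graph of \<open>perm_a\<close> and \<open>perm_b\<close>.\<close>

definition suborbit_walks :: "(nat list \<times> nat list list) list" where
  "suborbit_walks = (let a = perm_a; b = perm_b in
     [([0,1,2,4,8,15], []),
      ([0,1,3,5,9,14], [a,a,a,b,a,a,a,a,b,a,a,a,a,b]),
      ([0,1,3,4,10,12], [a,a,b,a,a,a,a,b,a,a,a,a,b,a,b,a,a,a,a]),
      ([0,1,2,5,11,13], [a,a,a,a,b,a,a,b,a,a,a,a,b,a,a,b,a,a,a,a,b,a,a,a,a,b,a,b,a]),
      ([0,3,5,7,10,11], [a,a,a,a,b,a,b,a,a,b,a,a,a,a,b,a,a,a,a,b,a,b,a,a,a,a,b,a,a])])"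

lemma base_point_fixed: "apply_perm perm_a base_point = base_point" "apply_perm perm_b base_point = base_point"
  by (simp_all add: base_point_def apply_perm_simps perm_a_def perm_b_def del: One_nat_def)

text \<open>The walks have 1, 15, 20, 30 and 30 vertices, 96 in all. This bounds the number of
  suborbits by five; that they are different comes from \<open>suborbit_invariants\<close>.\<close>

lemma suborbit_walks_exhaust:
  "set family1 \<subseteq> set (concat (map (\<lambda>(X, w). walk w X) suborbit_walks))"
  by (simp add: family1_eq suborbit_walks_def Let_def apply_perm_simps perm_a_def perm_b_def
      del: One_nat_def)

text \<open>A single walk that also uses \<open>perm_c\<close> links the suborbits, which gives
  transitivity.\<close>

lemma suborbits_connected:
  "fst ` set suborbit_walks \<subseteq> set (let a = perm_a; b = perm_b; c = perm_c in
     walk [c,b,a,c,b,c,a,a,a,c,a,a,b,c,b] base_point)"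
  by (simp add: suborbit_walks_def base_point_def Let_def apply_perm_simps perm_a_def perm_b_def perm_c_def
      del: One_nat_def)

lemma suborbit_representatives: "fst ` set suborbit_walks \<subseteq> set family1"
  by (simp add: suborbit_walks_def family1_eq Let_def del: One_nat_def)

section \<open>Intersection numbers and matrix products on lists\<close>

definition meet_card :: "nat list \<Rightarrow> nat list \<Rightarrow> nat" where
  "meet_card X Y = length (filter (\<lambda>x. x \<in> set X) Y)"

lemma meet_card_simps:
  "meet_card X [] = 0"
  "meet_card X (x # xs) = (if x \<in> set X then meet_card X xs + 1 else meet_card X xs)"
  by (simp_all add: meet_card_def)

definition common_disjoint :: "nat list \<Rightarrow> nat list \<Rightarrow> nat list list" where
  "common_disjoint X Y = filter (\<lambda>C. meet_card X C = 0 \<and> meet_card Y C = 0) family2"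

text \<open>Intersection numbers alone leave the suborbits of lengths 20 and 30 with
  \<open>\<bar>X \<inter> Y\<bar> = 3\<close> together; only in the first one is some member of \<open>\<Omega>\<^sub>2\<close> disjoint from both sets.\<close>

lemma suborbit_invariants:
  "distinct (map ((\<lambda>R. (meet_card base_point R, common_disjoint base_point R \<noteq> [])) \<circ> fst) suborbit_walks)"
  by (simp add: suborbit_walks_def common_disjoint_def base_point_def family2_eq Let_def meet_card_simps del: One_nat_def)

text \<open>The entry at \<open>X\<close> and \<open>Y\<close> of a product
  \<open>K L\<^sup>T\<close>, where \<open>K\<close> and \<open>L\<close> are the combinations of
  the matrices \<open>A\<^sub>n\<close> with coefficients \<open>k ! n\<close> and
  \<open>l ! n\<close>.\<close>

definition gram_list :: "int list \<Rightarrow> int list \<Rightarrow> nat list \<Rightarrow> nat list \<Rightarrow> int" where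
  "gram_list k l X Y = sum_list (map (\<lambda>C. k ! meet_card X C * l ! meet_card Y C) family2)"

text \<open>Both coefficient lists encode \<open>A\<^sub>3 - A\<^sub>1\<close>. One row, and in it
  one entry per suborbit, determines the whole product by invariance under the group.\<close>

lemma gram_list_16:
  "\<forall>R\<in>fst ` set suborbit_walks.
     gram_list [0,-1,0,1,0] [0,-1,0,1,0] base_point R = (if R = base_point then 16 else 0)"
  by (simp add: gram_list_def suborbit_walks_def base_point_def family2_eq Let_def meet_card_simps del: One_nat_def)

text \<open>The second coefficient list encodes 27 times the inverse transpose of
  \<open>A\<^sub>1 - A\<^sub>4\<close>. This identity serves the prime 2, where 16 is not a
  unit.\<close>

lemma gram_list_27:
  "\<forall>R\<in>fst ` set suborbit_walks.
     gram_list [0,1,0,0,-1] [-4,-3,1,2,-3] base_point R = (if R = base_point then 27 else 0)"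
  by (simp add: gram_list_def suborbit_walks_def base_point_def family2_eq Let_def meet_card_simps del: One_nat_def)

text \<open>The obstruction to an isomorphism: \<open>perm_a\<close> and \<open>perm_b\<close> fix
  \<open>base_point\<close>, so an equivariant map would send it to a common fixed point in the
  second family.\<close>

lemma no_common_fixed_point:
  "\<forall>X\<in>set family2. \<not> (apply_perm perm_a X = X \<and> apply_perm perm_b X = X)"
  by (simp add: family2_eq apply_perm_simps perm_a_def perm_b_def del: One_nat_def)

section \<open>The group preserving both families\<close>

lemma perm_of_permutes:
  assumes "distinct l" "set l = {..<length l}"
  shows "perm_of l permutes {..<length l}"
proof (rule bij_imp_permutes)
  have "bij_betw ((!) l) {..<length l} {..<length l}"
    using bij_betw_nth[OF assms(1) refl] assms(2) by simp
  then show "bij_betw (perm_of l) {..<length l} {..<length l}"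
    by (rule bij_betw_cong[THEN iffD1, rotated]) (simp add: perm_of_def)
qed (simp add: perm_of_def)

lemma set_apply_perm: "\<forall>x\<in>set X. x < length l \<Longrightarrow> set (apply_perm l X) = perm_of l ` set X"
  by (auto simp: apply_perm_def perm_of_def)

text \<open>Products are in diagrammatic order, which makes the image a right action.\<close>

definition octad_group :: "(nat \<Rightarrow> nat) monoid" where
  "octad_group =
    \<lparr> carrier = {g. g permutes {..<16} \<and> (`) g ` Omega1 = Omega1 \<and> (`) g ` Omega2 = Omega2},
      monoid.mult = (\<lambda>g h. h \<circ> g),
      one = id \<rparr>"

lemma carrier_octad_group:
  "g \<in> carrier octad_group \<longleftrightarrow> g permutes {..<16} \<and> (`) g ` Omega1 = Omega1 \<and> (`) g ` Omega2 = Omega2"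
  by (simp add: octad_group_def)

lemma image_image_inv:
  assumes "g permutes S" "(`) g ` \<Omega> = \<Omega>"
  shows "(`) (inv_into UNIV g) ` \<Omega> = \<Omega>"
proof -
  have "(`) (inv_into UNIV g) ` (`) g ` \<Omega> = \<Omega>"
    using permutes_inv_o(2)[OF assms(1)] by (simp add: image_comp comp_def)
  then show ?thesis using assms(2) by simp
qed

lemma group_octad_group: "group octad_group"
proof (rule groupI)
  fix g assume g: "g \<in> carrier octad_group"
  then have "inv_into UNIV g \<in> carrier octad_group"
    unfolding carrier_octad_group by (intro conjI permutes_inv image_image_inv) auto
  moreover have "inv_into UNIV g \<otimes>\<^bsub>octad_group\<^esub> g = \<one>\<^bsub>octad_group\<^esub>"
    using g permutes_inv_o(1)[of g "{..<16}"] by (simp add: octad_group_def)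
  ultimately show "\<exists>h\<in>carrier octad_group. h \<otimes>\<^bsub>octad_group\<^esub> g = \<one>\<^bsub>octad_group\<^esub>" by blast
next
  fix g h assume "g \<in> carrier octad_group" "h \<in> carrier octad_group"
  moreover have "(`) (h \<circ> g) ` \<Omega> = (`) h ` (`) g ` \<Omega>" for \<Omega> :: "nat set set"
    by (simp add: image_comp comp_def)
  ultimately show "g \<otimes>\<^bsub>octad_group\<^esub> h \<in> carrier octad_group"
    by (simp add: octad_group_def permutes_compose)
qed (auto simp: octad_group_def permutes_id)

lemma finite_octad_group: "finite (carrier octad_group)"
  by (rule finite_subset[OF _ finite_permutations[of "{..<16::nat}"]]) (auto simp: octad_group_def)

lemma right_action_octad_group:
  assumes "\<And>g. g \<in> carrier octad_group \<Longrightarrow> (`) g ` \<Omega> = \<Omega>"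
  shows "right_action octad_group \<Omega> (`)"
  using assms
  by (intro right_action.intro right_action_axioms.intro group_octad_group)
    (auto simp: octad_group_def image_comp)

lemma right_action_Omega1: "right_action octad_group Omega1 (`)"
  by (rule right_action_octad_group) (simp add: carrier_octad_group)

lemma right_action_Omega2: "right_action octad_group Omega2 (`)"
  by (rule right_action_octad_group) (simp add: carrier_octad_group)

interpretation A1: right_action octad_group Omega1 "(`)" by (rule right_action_Omega1)
interpretation A2: right_action octad_group Omega2 "(`)" by (rule right_action_Omega2)

lemma finite_Omega: "finite Omega1" "finite Omega2"
  by (simp_all add: Omega1_def Omega2_def)

text \<open>An injective map of a finite set into itself is onto, so the inclusions checked on lists
  suffice.\<close>

lemma perm_of_image_family:
  assumes "perm_of l permutes {..<16}" "length l = 16" "\<forall>X\<in>set F. \<forall>x\<in>set X. x < 16"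
    and "set (map (apply_perm l) F) \<subseteq> set F"
  shows "(`) (perm_of l) ` (set ` set F) = set ` set F"
proof (rule endo_inj_surj)
  show "(`) (perm_of l) ` (set ` set F) \<subseteq> set ` set F"
  proof clarify
    fix X assume X: "X \<in> set F"
    then have "perm_of l ` set X = set (apply_perm l X)"
      using assms(2,3) set_apply_perm[of X l] by simp
    then show "perm_of l ` set X \<in> set ` set F" using X assms(4) by auto
  qed
  show "inj_on ((`) (perm_of l)) (set ` set F)"
    using permutes_inj[OF assms(1)] by (auto intro: inj_on_image inj_on_subset)
qed simp

text \<open>Splits statements about the numbers below 16 into explicit cases.\<close>

lemma lessThan_16: "{..<16} = set vectors"
proof -
  have "vectors = [0..<16]" by code_simp
  then show ?thesis by (simp add: atLeast_upt)
qed

lemma perms_permute: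
  "perm_of perm_a permutes {..<16}" "perm_of perm_b permutes {..<16}"
  "perm_of perm_c permutes {..<16}" "perm_of perm_t permutes {..<16}"
proof -
  have *: "perm_of l permutes {..<16}" if "length l = 16" "distinct l" "set l = {..<16}" for l
    using perm_of_permutes[of l] that by simp
  show "perm_of perm_a permutes {..<16}" "perm_of perm_b permutes {..<16}"
    "perm_of perm_c permutes {..<16}" "perm_of perm_t permutes {..<16}"
    by (intro *; auto simp: lessThan_16 vectors_def perm_a_def perm_b_def perm_c_def perm_t_def)+
qed

lemma length_perms: "length perm_a = 16" "length perm_b = 16" "length perm_c = 16" "length perm_t = 16"
  by (simp_all add: perm_a_def perm_b_def perm_c_def perm_t_def)

lemma perms_in_octad_group:
  "perm_of perm_a \<in> carrier octad_group" "perm_of perm_b \<in> carrier octad_group"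
  "perm_of perm_c \<in> carrier octad_group"
  unfolding carrier_octad_group Omega1_def Omega2_def
  by (intro conjI perms_permute perm_of_image_family length_perms family1_less family2_less
      perms_preserve_family1 perms_preserve_family2)+

text \<open>The letters met along the walk multiply, in diagrammatic order, to an element of
  \<open>S\<close>. With \<open>S\<close> a stabilizer this describes suborbits, with
  \<open>S\<close> the whole group transitivity.\<close>

lemma walk_reachable:
  assumes S: "subgroup S octad_group"
    and ls: "\<forall>l\<in>set ls. length l = 16 \<and> perm_of l \<in> S"
    and X: "\<forall>x\<in>set X. x < 16" and Y: "Y \<in> set (walk ls X)"
  shows "\<exists>g\<in>S. g ` set X = set Y"
proof -
  have id: "id \<in> S" using subgroup.one_closed[OF S] by (simp add: octad_group_def)
  show ?thesis
    using ls X Y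
  proof (induction ls arbitrary: X)
    case Nil
    then show ?case by (auto intro: bexI[OF _ id])
  next
    case (Cons l ls)
    show ?case
    proof (cases "Y = X")
      case True
      then show ?thesis by (auto intro: bexI[OF _ id])
    next
      case False
      have l: "perm_of l \<in> S" "length l = 16" using Cons.prems by auto
      then have img: "set (apply_perm l X) = perm_of l ` set X"
        using Cons.prems set_apply_perm by simp
      have "perm_of l permutes {..<16}"
        using subgroup.mem_carrier[OF S l(1)] by (simp add: carrier_octad_group)
      then have "\<forall>x\<in>set (apply_perm l X). x < 16"
        using Cons.prems(2) img by (auto dest: permutes_in_image)
      then obtain g where g: "g \<in> S" "g ` set (apply_perm l X) = set Y"
        using Cons.IH[of "apply_perm l X"] Cons.prems False by auto
      have "perm_of l \<otimes>\<^bsub>octad_group\<^esub> g \<in> S"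
        using S l(1) g(1) by (rule subgroup.m_closed)
      then show ?thesis
        using g(2) img by (intro bexI[of _ "perm_of l \<otimes>\<^bsub>octad_group\<^esub> g"]) (auto simp: octad_group_def)
    qed
  qed
qed

section \<open>Suborbits and transitivity on the first family\<close>

abbreviation "point \<equiv> set base_point"
abbreviation "representatives \<equiv> set ` fst ` set suborbit_walks"

lemma base_point_in_family1: "base_point \<in> fst ` set suborbit_walks"
  by (simp add: suborbit_walks_def base_point_def Let_def)

lemma point_in_Omega1: "point \<in> Omega1"
  using base_point_in_family1 suborbit_representatives by (auto simp: Omega1_def)

lemma suborbit_perms:
  "\<forall>(X, w)\<in>set suborbit_walks. \<forall>l\<in>set w. l = perm_a \<or> l = perm_b"
  by (simp add: suborbit_walks_def Let_def)

lemma perms_stabilize_point: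
  "perm_of perm_a \<in> stabilizer octad_group (`) point" "perm_of perm_b \<in> stabilizer octad_group (`) point"
proof -
  have "\<forall>x\<in>point. x < 16" by (simp add: base_point_def)
  then have "perm_of perm_a ` point = point" "perm_of perm_b ` point = point"
    using set_apply_perm[of base_point perm_a] set_apply_perm[of base_point perm_b]
    by (simp_all add: length_perms base_point_fixed)
  then show "perm_of perm_a \<in> stabilizer octad_group (`) point"
    "perm_of perm_b \<in> stabilizer octad_group (`) point"
    by (simp_all add: stabilizer_def perms_in_octad_group)
qed

lemma suborbit_representatives_Omega1: "representatives \<subseteq> Omega1"
  using suborbit_representatives by (auto simp: Omega1_def)

lemma suborbit_exhaust:
  assumes "Y \<in> Omega1"
  shows "\<exists>R\<in>representatives. \<exists>h\<in>stabilizer octad_group (`) point. h ` R = Y"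
proof -
  obtain Y' where Y': "Y' \<in> set family1" "Y = set Y'" using assms by (auto simp: Omega1_def)
  then obtain X w where w: "(X, w) \<in> set suborbit_walks" "Y' \<in> set (walk w X)"
    using suborbit_walks_exhaust by fastforce
  have "X \<in> set family1" using w(1) suborbit_representatives by force
  then have "\<exists>g\<in>stabilizer octad_group (`) point. g ` set X = set Y'"
    using w suborbit_perms perms_stabilize_point family1_less A1.subgroup_stabilizer[OF point_in_Omega1]
    by (intro walk_reachable[of _ w]) (fastforce simp: length_perms)+
  then show ?thesis using w(1) Y'(2) by force
qed

text \<open>The connecting walk leads from \<open>point\<close> to a representative, and the
  stabilizer of \<open>point\<close> leads from there to \<open>Y\<close>.\<close>

lemma transitive_Omega1:
  assumes "Y \<in> Omega1"
  shows "\<exists>g\<in>carrier octad_group. g ` point = Y"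
proof -
  obtain X h where X: "X \<in> fst ` set suborbit_walks" and h: "h \<in> carrier octad_group" "h ` set X = Y"
    using suborbit_exhaust[OF assms] by (auto simp: stabilizer_def)
  obtain ls where ls: "\<forall>l\<in>set ls. l = perm_a \<or> l = perm_b \<or> l = perm_c" "X \<in> set (walk ls base_point)"
  proof
    show "X \<in> set (walk (let a = perm_a; b = perm_b; c = perm_c in [c,b,a,c,b,c,a,a,a,c,a,a,b,c,b]) base_point)"
      using X suborbits_connected by (auto simp: Let_def)
  qed (simp add: Let_def)
  have "\<exists>g\<in>carrier octad_group. g ` point = set X"
    using ls perms_in_octad_group group.subgroup_self[OF group_octad_group]
    by (intro walk_reachable[of _ ls]) (auto simp: length_perms base_point_def)
  then obtain g where "g \<in> carrier octad_group" "g ` point = set X" by blast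
  then have "(g \<otimes>\<^bsub>octad_group\<^esub> h) ` point = Y" "g \<otimes>\<^bsub>octad_group\<^esub> h \<in> carrier octad_group"
    using h A1.m_closed by (auto simp: A1.act_mult point_in_Omega1)
  then show ?thesis by blast
qed

section \<open>The involution interchanging the two families\<close>

definition swap :: "nat \<Rightarrow> nat" where "swap = perm_of perm_t"

lemma swap_swap: "swap (swap x) = x"
proof (cases "x < 16")
  case True
  then have "x \<in> set vectors" by (simp flip: lessThan_16)
  then show ?thesis by (auto simp: vectors_def swap_def perm_of_def perm_t_def)
qed (simp add: swap_def perm_of_def perm_t_def)

lemma swap_image_swap: "swap ` swap ` X = X"
  by (simp add: image_comp comp_def swap_swap)

lemma inj_swap: "inj swap"
  by (metis injI swap_swap)

lemma swap_Omega1: "(`) swap ` Omega1 = Omega2"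
proof -
  have "swap ` set X = set (apply_perm perm_t X)" if "X \<in> set family1" for X
    using set_apply_perm[of X perm_t] family1_less that by (auto simp: swap_def length_perms)
  then show ?thesis by (auto simp: Omega1_def Omega2_def family2_def image_image)
qed

lemma swap_Omega2: "(`) swap ` Omega2 = Omega1"
proof -
  have "(`) swap ` (`) swap ` Omega1 = (\<lambda>X. X) ` Omega1"
    unfolding image_image by (simp add: image_image swap_swap)
  then show ?thesis by (simp add: swap_Omega1)
qed

lemma bij_betw_swap: "bij_betw ((`) swap) Omega2 Omega1"
  by (rule bij_betw_byWitness[where f' = "(`) swap"])
    (use swap_Omega1 swap_Omega2 in \<open>auto simp: swap_image_swap\<close>)

text \<open>\<open>swap\<close> interchanges the two families that define the group, hence
  normalizes it.\<close>

lemma swap_conjugate: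
  assumes "g \<in> carrier octad_group"
  shows "swap \<circ> g \<circ> swap \<in> carrier octad_group"
proof -
  have "(`) (swap \<circ> g \<circ> swap) ` \<Omega> = (`) swap ` (`) g ` (`) swap ` \<Omega>" for \<Omega>
    by (simp add: image_comp comp_def)
  then show ?thesis
    using assms perms_permute(4) swap_Omega1 swap_Omega2
    by (auto simp: carrier_octad_group permutes_compose swap_def[symmetric])
qed

text \<open>Conjugation by \<open>swap\<close> transports transitivity from the first family,
  without a second computation.\<close>

lemma transitive_Omega2:
  assumes "Y \<in> Omega2"
  shows "\<exists>g\<in>carrier octad_group. g ` swap ` point = Y"
proof -
  have "swap ` Y \<in> Omega1" using assms swap_Omega2 by blast
  then obtain g where g: "g \<in> carrier octad_group" "g ` point = swap ` Y"
    using transitive_Omega1 by blast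
  have "(swap \<circ> g \<circ> swap) ` swap ` point = swap ` g ` swap ` swap ` point"
    by (simp add: image_image)
  also have "\<dots> = Y" using g by (simp add: swap_image_swap)
  finally show ?thesis using swap_conjugate[OF g(1)] by blast
qed

section \<open>Matrix products on sets\<close>

lemma set_inj_family2: "inj_on set (set family2)"
  using family2_sorted by (auto intro!: inj_onI strict_sorted_equal)

lemma set_inj_family1: "inj_on set (set family1)"
  using family1_sorted by (auto intro!: inj_onI strict_sorted_equal)

lemma strict_sorted_imp_distinct: "sorted_wrt (<) (X :: nat list) \<Longrightarrow> distinct X"
  by (simp add: strict_sorted_iff)

lemma meet_card_eq: "sorted_wrt (<) Y \<Longrightarrow> meet_card X Y = card (set X \<inter> set Y)"
proof -
  assume "sorted_wrt (<) Y"
  then have "distinct Y" using strict_sorted_imp_distinct by blast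
  then have "meet_card X Y = card (set (filter (\<lambda>x. x \<in> set X) Y))"
    unfolding meet_card_def by (simp only: distinct_card distinct_filter)
  also have "set (filter (\<lambda>x. x \<in> set X) Y) = set X \<inter> set Y" by auto
  finally show ?thesis .
qed


definition gram :: "(nat \<Rightarrow> int) \<Rightarrow> (nat \<Rightarrow> int) \<Rightarrow> nat set \<Rightarrow> nat set \<Rightarrow> int" where
  "gram k l X Y = (\<Sum>C\<in>Omega2. k (card (X \<inter> C)) * l (card (Y \<inter> C)))"

lemma gram_eq_gram_list: "gram ((!) k) ((!) l) (set X) (set Y) = gram_list k l X Y"
proof -
  have "gram ((!) k) ((!) l) (set X) (set Y)
      = (\<Sum>C\<in>set family2. k ! card (set X \<inter> set C) * l ! card (set Y \<inter> set C))"
    unfolding gram_def Omega2_def by (simp add: sum.reindex[OF set_inj_family2])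
  also have "\<dots> = (\<Sum>C\<in>set family2. k ! meet_card X C * l ! meet_card Y C)"
    using family2_sorted by (intro sum.cong) (simp_all add: meet_card_eq)
  finally show ?thesis
    by (simp add: gram_list_def sum_list_distinct_conv_sum_set[OF distinct_family2])
qed

lemma gram_commute: "gram k l X Y = gram l k Y X"
  by (simp add: gram_def mult.commute)

lemma card_image_Int_octad_group:
  assumes "g \<in> carrier octad_group"
  shows "card (g ` X \<inter> g ` Y) = card (X \<inter> Y)"
proof -
  have "inj g" using assms permutes_inj by (auto simp: carrier_octad_group)
  then show ?thesis by (metis card_image image_Int inj_on_subset subset_UNIV)
qed

text \<open>The group permutes the index set \<open>Omega2\<close> of the sum and preserves
  intersection sizes.\<close>

lemma gram_invariant:
  assumes "g \<in> carrier octad_group"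
  shows "gram k l (g ` X) (g ` Y) = gram k l X Y"
proof -
  have "gram k l (g ` X) (g ` Y) = (\<Sum>C\<in>Omega2. k (card (g ` X \<inter> g ` C)) * l (card (g ` Y \<inter> g ` C)))"
    unfolding gram_def by (rule sum.reindex_bij_betw[symmetric, OF A2.bij_betw_act[OF assms]])
  then show ?thesis by (simp add: gram_def card_image_Int_octad_group[OF assms])
qed

text \<open>Consequently an invariant function of pairs is determined by its values at
  \<open>point\<close> and the five representatives.\<close>

lemma orbital_representative:
  assumes "X \<in> Omega1" "Y \<in> Omega1"
  shows "\<exists>g\<in>carrier octad_group. \<exists>R\<in>representatives. g ` point = X \<and> g ` R = Y"
proof -
  obtain g where g: "g \<in> carrier octad_group" "g ` point = X"
    using transitive_Omega1[OF assms(1)] by blast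
  have "(inv\<^bsub>octad_group\<^esub> g) ` Y \<in> Omega1" by (rule A1.act_closed[OF A1.inv_closed[OF g(1)] assms(2)])
  then obtain R h where R: "R \<in> representatives" "h \<in> stabilizer octad_group (`) point"
      "h ` R = (inv\<^bsub>octad_group\<^esub> g) ` Y"
    using suborbit_exhaust[of "(inv\<^bsub>octad_group\<^esub> g) ` Y"] by blast
  then have h: "h \<in> carrier octad_group" "h ` point = point" by (auto simp: stabilizer_def)
  have RO: "R \<in> Omega1" using R(1) suborbit_representatives_Omega1 by blast
  have "(h \<otimes>\<^bsub>octad_group\<^esub> g) ` point = X" "(h \<otimes>\<^bsub>octad_group\<^esub> g) ` R = Y"
    using A1.act_mult[OF h(1) g(1) point_in_Omega1] A1.act_mult[OF h(1) g(1) RO]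
      A1.act_act_inv[OF g(1) assms(2)] g(2) h(2) R(3) by simp_all
  then show ?thesis using R(1) h(1) g(1) by blast
qed

lemma inj_on_set_representatives: "inj_on set (fst ` set suborbit_walks)"
  by (rule inj_on_subset[OF set_inj_family1 suborbit_representatives])

text \<open>Both sides are invariant under the group, so the five computed entries give the whole
  matrix.\<close>

lemma gram_eq_scalar:
  assumes "\<forall>R\<in>fst ` set suborbit_walks. gram_list k l base_point R = (if R = base_point then m else 0)"
    and "X \<in> Omega1" "Y \<in> Omega1"
  shows "gram ((!) k) ((!) l) X Y = (if X = Y then m else 0)"
proof -
  obtain g R where g: "g \<in> carrier octad_group" and R: "R \<in> fst ` set suborbit_walks"
    and XY: "g ` point = X" "g ` set R = Y"
    using orbital_representative[OF assms(2,3)] by blast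
  have "inj g" using g permutes_inj by (auto simp: carrier_octad_group)
  then have "X = Y \<longleftrightarrow> point = set R" using XY by (auto simp: inj_image_eq_iff)
  also have "\<dots> \<longleftrightarrow> R = base_point"
    using inj_on_eq_iff[OF inj_on_set_representatives base_point_in_family1 R] by auto
  finally show ?thesis
    using bspec[OF assms(1) R] gram_invariant[OF g, of "(!) k" "(!) l" point "set R"] XY
    by (simp add: gram_eq_gram_list)
qed

text \<open>The product in the other order. As \<open>swap\<close> is an involution,
  \<open>swap\<close>
  E\<open>meets\<close>C\<open>in as many points as\<close>E\<open>meets\<close>swap
  \<open>C\<close>; reindexing along \<open>swap\<close> thus leads back to the first
  product.\<close>

lemma gram_eq_scalar_Omega2:
  assumes "\<forall>R\<in>fst ` set suborbit_walks. gram_list k l base_point R = (if R = base_point then m else 0)"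
    and C: "C \<in> Omega2" and D: "D \<in> Omega2"
  shows "(\<Sum>X\<in>Omega1. l ! card (X \<inter> C) * k ! card (X \<inter> D)) = (if C = D then m else 0)"
proof -
  have card_swap: "card (swap ` E \<inter> C) = card (swap ` C \<inter> E)" for E C
  proof -
    have "swap ` E \<inter> C = swap ` (E \<inter> swap ` C)"
      by (simp add: image_Int inj_swap swap_image_swap)
    then show ?thesis
      using card_image[OF inj_on_subset[OF inj_swap subset_UNIV]] by (metis inf_commute)
  qed
  have "(\<Sum>X\<in>Omega1. l ! card (X \<inter> C) * k ! card (X \<inter> D))
      = (\<Sum>E\<in>Omega2. l ! card (swap ` E \<inter> C) * k ! card (swap ` E \<inter> D))"
    by (rule sum.reindex_bij_betw[symmetric, OF bij_betw_swap])
  also have "\<dots> = gram ((!) k) ((!) l) (swap ` D) (swap ` C)"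
    by (simp add: gram_def card_swap mult.commute)
  also have "\<dots> = (if swap ` D = swap ` C then m else 0)"
    using C D swap_Omega2 by (intro gram_eq_scalar[OF assms(1)]) blast+
  finally show ?thesis by (auto simp: inj_image_eq_iff[OF inj_swap])
qed

section \<open>Rank, non-isomorphism and local equivalence of the coset spaces\<close>

definition stab1 :: "(nat \<Rightarrow> nat) set" where "stab1 = stabilizer octad_group (`) point"
definition stab2 :: "(nat \<Rightarrow> nat) set" where "stab2 = stabilizer octad_group (`) (swap ` point)"

lemma swap_point: "swap ` point \<in> Omega2"
  using point_in_Omega1 swap_Omega1 by blast

lemma subgroup_stab: "subgroup stab1 octad_group" "subgroup stab2 octad_group"
  unfolding stab1_def stab2_def
  by (rule A1.subgroup_stabilizer A2.subgroup_stabilizer point_in_Omega1 swap_point)+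

lemma rcosets_stab1: "gset_isomorphic octad_group (rcosets\<^bsub>octad_group\<^esub> stab1) (coset_act octad_group) Omega1 (`)"
  unfolding stab1_def using point_in_Omega1 transitive_Omega1 by (rule A1.rcosets_stabilizer_isomorphic)

lemma rcosets_stab2: "gset_isomorphic octad_group (rcosets\<^bsub>octad_group\<^esub> stab2) (coset_act octad_group) Omega2 (`)"
  unfolding stab2_def using swap_point transitive_Omega2 by (rule A2.rcosets_stabilizer_isomorphic)

lemma action_rank_Omega1: "action_rank octad_group Omega1 (`) = 5"
proof -
  \<comment> \<open>The invariant of \<open>suborbit_invariants\<close>, stated for sets so that the
    group acts on its arguments.\<close>
  define F where "F X Y = (card (X \<inter> Y), \<exists>C\<in>Omega2. X \<inter> C = {} \<and> Y \<inter> C = {})" for X Y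
  have F_eq: "F point (set R) = (meet_card base_point R, common_disjoint base_point R \<noteq> [])"
    if R: "R \<in> fst ` set suborbit_walks" for R
  proof -
    have 1: "meet_card base_point R = card (point \<inter> set R)"
      using R suborbit_representatives family1_sorted by (intro meet_card_eq) blast
    have 2: "meet_card X C = 0 \<longleftrightarrow> set X \<inter> set C = {}" if "C \<in> set family2" for X C
      using meet_card_eq[of C X] family2_sorted that by simp
    show ?thesis
      by (auto simp: F_def 1 2 common_disjoint_def filter_empty_conv Omega2_def)
  qed
  have dist: "distinct (map fst suborbit_walks)"
    using suborbit_invariants by (auto simp: distinct_map intro: inj_on_imageI2)
  have "inj_on (\<lambda>R. F point (set R)) (fst ` set suborbit_walks)"
    using suborbit_invariants F_eq
    by (auto simp: distinct_map inj_on_def)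
  then have inj: "inj_on (F point) representatives"
    by (auto simp: inj_on_def)
  have "action_rank octad_group Omega1 (`) = card representatives"
  proof (rule A1.action_rank_eq_card_suborbits[where F = F and R = representatives, OF point_in_Omega1 transitive_Omega1
        suborbit_representatives_Omega1 suborbit_exhaust _ inj])
    fix g X Y assume g: "g \<in> carrier octad_group"
    then have img: "(`) g ` Omega2 = Omega2" and inj: "inj g"
      using permutes_inj by (auto simp: carrier_octad_group)
    \<comment> \<open>Since \<open>g\<close> permutes \<open>Omega2\<close>, a common disjoint
      member for \<open>X\<close> and \<open>Y\<close> is carried to one for their images, and
      conversely.\<close>
    have "(\<exists>C\<in>Omega2. g ` X \<inter> C = {} \<and> g ` Y \<inter> C = {})
        \<longleftrightarrow> (\<exists>C\<in>(`) g ` Omega2. g ` X \<inter> C = {} \<and> g ` Y \<inter> C = {})" by (simp only: img)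
    also have "\<dots> \<longleftrightarrow> (\<exists>C\<in>Omega2. X \<inter> C = {} \<and> Y \<inter> C = {})"
      by (simp add: image_Int[OF inj, symmetric])
    finally show "F (g ` X) (g ` Y) = F X Y"
      by (simp add: F_def card_image_Int_octad_group[OF g])
  qed
  also have "\<dots> = card (fst ` set suborbit_walks)"
    by (rule card_image[OF inj_on_set_representatives])
  also have "\<dots> = length suborbit_walks"
    using distinct_card[OF dist] by simp
  finally show ?thesis by (simp add: suborbit_walks_def Let_def)
qed

lemma not_isomorphic_Omega: "\<not> gset_isomorphic octad_group Omega1 (`) Omega2 (`)"
proof
  assume "gset_isomorphic octad_group Omega1 (`) Omega2 (`)"
  then obtain f where f: "bij_betw f Omega1 Omega2"
      "\<And>g X. g \<in> carrier octad_group \<Longrightarrow> X \<in> Omega1 \<Longrightarrow> f (g ` X) = g ` f X"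
    by (auto simp: gset_isomorphic_def)
  obtain C where C: "C \<in> set family2" "f point = set C"
    using bij_betw_apply[OF f(1) point_in_Omega1] by (auto simp: Omega2_def)
  \<comment> \<open>By equivariance, whatever fixes \<open>point\<close> also fixes its image under
    \<open>f\<close>.\<close>
  have fixed: "apply_perm l C = C"
    if "perm_of l \<in> stabilizer octad_group (`) point" "length l = 16"
      "set (map (apply_perm l) family2) \<subseteq> set family2" for l
  proof (rule inj_onD[OF set_inj_family2])
    have "perm_of l ` set C = set C"
      using f(2)[of "perm_of l" point] that(1) point_in_Omega1 C(2) by (simp add: stabilizer_def)
    then show "set (apply_perm l C) = set C"
      using set_apply_perm[of C l] family2_less C(1) that(2) by simp
  qed (use C(1) that(3) in auto)
  show False
    using no_common_fixed_point C(1) fixed perms_stabilize_point length_perms perms_preserve_family2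
    by blast
qed

text \<open>Pulling the intersection matrices back along the bijections \<open>f1\<close> and
  \<open>f2\<close> gives an intertwiner directly between the coset modules.\<close>

lemma gmodule_isomorphic_rcosets:
  assumes kl: "\<forall>R\<in>fst ` set suborbit_walks. gram_list k l base_point R = (if R = base_point then m else 0)"
    and p: "p > 0" "coprime m (int p)"
  shows "gmodule_isomorphic (padic_int p) octad_group
    (free_mod (padic_int p) (rcosets\<^bsub>octad_group\<^esub> stab1))
    (free_act octad_group (rcosets\<^bsub>octad_group\<^esub> stab1) (coset_act octad_group))
    (free_mod (padic_int p) (rcosets\<^bsub>octad_group\<^esub> stab2))
    (free_act octad_group (rcosets\<^bsub>octad_group\<^esub> stab2) (coset_act octad_group))"
proof -
  obtain f1 where f1: "bij_betw f1 (rcosets\<^bsub>octad_group\<^esub> stab1) Omega1"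
      "\<And>g A. g \<in> carrier octad_group \<Longrightarrow> A \<in> rcosets\<^bsub>octad_group\<^esub> stab1 \<Longrightarrow> f1 (coset_act octad_group g A) = g ` f1 A"
    using rcosets_stab1 by (auto simp: gset_isomorphic_def)
  obtain f2 where f2: "bij_betw f2 (rcosets\<^bsub>octad_group\<^esub> stab2) Omega2"
      "\<And>g A. g \<in> carrier octad_group \<Longrightarrow> A \<in> rcosets\<^bsub>octad_group\<^esub> stab2 \<Longrightarrow> f2 (coset_act octad_group g A) = g ` f2 A"
    using rcosets_stab2 by (auto simp: gset_isomorphic_def)
  show ?thesis
  proof (rule gmodule_isomorphic_padic_matrix[where K = "\<lambda>A B. k ! card (f1 A \<inter> f2 B)"
        and L = "\<lambda>B A. l ! card (f1 A \<inter> f2 B)"])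
    fix A B assume A: "A \<in> rcosets\<^bsub>octad_group\<^esub> stab1" and B: "B \<in> rcosets\<^bsub>octad_group\<^esub> stab1"
    have "(\<Sum>C\<in>rcosets\<^bsub>octad_group\<^esub> stab2. k ! card (f1 A \<inter> f2 C) * l ! card (f1 B \<inter> f2 C))
        = gram ((!) k) ((!) l) (f1 A) (f1 B)"
      unfolding gram_def by (rule sum.reindex_bij_betw[OF f2(1)])
    also have "\<dots> = (if f1 A = f1 B then m else 0)"
      using A B bij_betw_apply[OF f1(1)] by (intro gram_eq_scalar[OF kl]) auto
    also have "f1 A = f1 B \<longleftrightarrow> A = B"
      using A B f1(1) by (auto simp: bij_betw_def inj_on_eq_iff)
    finally show "(\<Sum>C\<in>rcosets\<^bsub>octad_group\<^esub> stab2. k ! card (f1 A \<inter> f2 C) * l ! card (f1 B \<inter> f2 C))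
        = (if A = B then m else 0)" .
  next
    fix A B assume A: "A \<in> rcosets\<^bsub>octad_group\<^esub> stab2" and B: "B \<in> rcosets\<^bsub>octad_group\<^esub> stab2"
    have "(\<Sum>C\<in>rcosets\<^bsub>octad_group\<^esub> stab1. l ! card (f1 C \<inter> f2 A) * k ! card (f1 C \<inter> f2 B))
        = (\<Sum>X\<in>Omega1. l ! card (X \<inter> f2 A) * k ! card (X \<inter> f2 B))"
      by (rule sum.reindex_bij_betw[OF f1(1)])
    also have "\<dots> = (if f2 A = f2 B then m else 0)"
      using A B bij_betw_apply[OF f2(1)] by (intro gram_eq_scalar_Omega2[OF kl]) auto
    also have "f2 A = f2 B \<longleftrightarrow> A = B"
      using A B f2(1) by (auto simp: bij_betw_def inj_on_eq_iff)
    finally show "(\<Sum>C\<in>rcosets\<^bsub>octad_group\<^esub> stab1. l ! card (f1 C \<inter> f2 A) * k ! card (f1 C \<inter> f2 B))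
        = (if A = B then m else 0)" .
  next
    show "finite (rcosets\<^bsub>octad_group\<^esub> stab1)" "finite (rcosets\<^bsub>octad_group\<^esub> stab2)"
      using f1(1) f2(1) finite_Omega bij_betw_finite by blast+
  qed (simp_all add: right_action_rcosets group_octad_group subgroup_stab f1(2) f2(2)
      card_image_Int_octad_group p)
qed

lemma locally_integrally_equivalent_stab1_stab2: "locally_integrally_equivalent octad_group stab1 stab2"
  unfolding locally_integrally_equivalent_def
proof (intro allI impI)
  fix p :: nat assume p: "prime p"
  show "gmodule_isomorphic (padic_int p) octad_group
    (free_mod (padic_int p) (rcosets\<^bsub>octad_group\<^esub> stab1))
    (free_act octad_group (rcosets\<^bsub>octad_group\<^esub> stab1) (coset_act octad_group))
    (free_mod (padic_int p) (rcosets\<^bsub>octad_group\<^esub> stab2))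
    (free_act octad_group (rcosets\<^bsub>octad_group\<^esub> stab2) (coset_act octad_group))"
  \<comment> \<open>27 is a unit at 2, and 16 is a unit at every odd prime.\<close>
  proof (cases "p = 2")
    case True
    have "coprime (3 ^ 3) (2 :: int)" by (intro coprime_power_left_iff[THEN iffD2]) simp
    then have "coprime 27 (int p)" using True by simp
    then show ?thesis
      by (intro gmodule_isomorphic_rcosets[OF gram_list_27] prime_gt_0_nat[OF p])
  next
    case False
    then have "odd p" using p prime_odd_nat[of p] prime_ge_2_nat[of p] by linarith
    then have "coprime (2 ^ 4) (int p)" by (intro coprime_power_left_iff[THEN iffD2]) simp
    then have "coprime 16 (int p)" by simp
    then show ?thesis
      by (intro gmodule_isomorphic_rcosets[OF gram_list_16] prime_gt_0_nat[OF p])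
  qed
qed

theorem mainTheorem7:
  shows "\<exists>(G :: (nat \<Rightarrow> nat) monoid) H1 H2.
    group G \<and> finite (carrier G) \<and> subgroup H1 G \<and> subgroup H2 G \<and>
    action_rank G (rcosets\<^bsub>G\<^esub> H1) (coset_act G) = 5 \<and>
    locally_integrally_equivalent G H1 H2 \<and>
    \<not> gset_isomorphic G (rcosets\<^bsub>G\<^esub> H1) (coset_act G) (rcosets\<^bsub>G\<^esub> H2) (coset_act G)"
proof (intro exI conjI)
  show "group octad_group" by (rule group_octad_group)
  show "finite (carrier octad_group)" by (rule finite_octad_group)
  show "subgroup stab1 octad_group" "subgroup stab2 octad_group" by (rule subgroup_stab)+
  show "locally_integrally_equivalent octad_group stab1 stab2" by (rule locally_integrally_equivalent_stab1_stab2)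
  show "action_rank octad_group (rcosets\<^bsub>octad_group\<^esub> stab1) (coset_act octad_group) = 5"
    using action_rank_gset_isomorphic[OF rcosets_stab1] action_rank_Omega1
      right_action_rcosets[OF group_octad_group subgroup_stab(1)] by simp
  \<comment> \<open>Composed with the orbit-stabilizer isomorphisms, an isomorphism of coset spaces
    would identify the two families.\<close>
  show "\<not> gset_isomorphic octad_group (rcosets\<^bsub>octad_group\<^esub> stab1) (coset_act octad_group)
      (rcosets\<^bsub>octad_group\<^esub> stab2) (coset_act octad_group)"
    using gset_isomorphic_trans[OF gset_isomorphic_sym[OF rcosets_stab1] gset_isomorphic_trans[OF _ rcosets_stab2]]
      right_action_rcosets[OF group_octad_group subgroup_stab(1)] not_isomorphic_Omega by blast
qed

end
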